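(* Let $0\le\alpha<1$ and let $n\ge k\ge 2$ be integers. The digraph $\mathcal{T}_n^{k*}$ is the unique (up to isomorphism) digraph which has the minimum $D_\alpha$ spectral radius $\mu_\alpha$ among all digraphs in $\mathcal{C}_n^k$.
   Context: Digraphs are finite and simple (no loops, no multiple arcs; two opposite arcs $(u,v),(v,u)$ are allowed). A digraph is strongly connected if for every ordered pair of vertices there is a directed path from the first to the second. For a strongly connected digraph $G$ with vertices $v_1,\dots,v_n$, $D(G)=(d_{ij})$ is the distance matrix, where $d_{ij}$ is the length of a shortest directed path from $v_i$ to $v_j$; $D_i=\sum_{j=1}^n d_{ij}$ is the transmission of $v_i$; $Diag(Tr)=\mathrm{diag}(D_1,\dots,D_n)$; and $D_\alpha(G)=\alpha\, Diag(Tr)+(1-\alpha)D(G)$. The $D_\alpha$ spectral radius $\mu_\alpha(G)$ is the spectral radius of $D_\alpha(G)$, i.e. its eigenvalue of largest modulus. A digraph is acyclic if it has no directed cycle (two opposite arcs form a directed cycle of length 2). A set $F\subset V(G)$ is acyclic if the induced subdigraph $G[F]$ is acyclic. The dichromatic number $\chi(G)$ is the minimum $k$ such that $V(G)$ can be partitioned into $k$ acyclic sets. $\mathcal{C}_n^k$ denotes the set of strongly connected digraphs of order $n$ with $\chi(G)=k$. A tournament is obtained by orienting each edge of an undirected complete graph; a tournament on $m$ vertices is transitive if its set of outdegrees is $\{0,1,\dots,m-1\}$. $\mathcal{T}_n^k$ denotes the set of digraphs of order $n$ whose vertex set is partitioned into nonempty sets $V^1\cup\dots\cup V^k$ such that each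 $V^i$ induces a transitive tournament and, for all $i\ne j$, both arcs $(u,v)$ and $(v,u)$ are present for every $u\in V^i$, $v\in V^j$. $\mathcal{T}_n^{k*}$ is the digraph in $\mathcal{T}_n^k$ (unique up to isomorphism) with $\big||V^i|-|V^j|\big|\le 1$ for all $i,j\in\{1,\dots,k\}$. *)

theory Defs
  imports
    "Graph_Theory.Digraph_Isomorphism"
    "Graph_Theory.Shortest_Path"
    "HOL-Library.Disjoint_Sets"
    "Jordan_Normal_Form.Spectral_Radius"
begin

text \<open>
  Finite simple digraphs are the library locale \<^locale>\<open>digraph\<close>: finitely many vertices and arcs,
  no loops, no parallel arcs (opposite arcs are allowed).
\<close>

section \<open>Dichromatic number\<close>

text \<open>A library cycle is any nonempty closed walk without repeated vertices; in particular a pair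
  of opposite arcs is a cycle.\<close>

definition acyclic_digraph :: "('a, 'b) pre_digraph \<Rightarrow> bool" where
  "acyclic_digraph G \<longleftrightarrow> \<not> (\<exists>p. pre_digraph.cycle G p)"

definition acyclic_set :: "('a, 'b) pre_digraph \<Rightarrow> 'a set \<Rightarrow> bool" where
  "acyclic_set G F \<longleftrightarrow> F \<subseteq> verts G \<and> acyclic_digraph (induce_subgraph G F)"

definition dichromatic_number :: "('a, 'b) pre_digraph \<Rightarrow> nat" where
  "dichromatic_number G =
     (LEAST k. \<exists>P. partition_on (verts G) P \<and> card P = k \<and> (\<forall>F\<in>P. acyclic_set G F))"

definition dichromatic_class :: "nat \<Rightarrow> nat \<Rightarrow> ('a, 'b) pre_digraph set" where
  "dichromatic_class n k =
     {G. digraph G \<and> strongly_connected G \<and> card (verts G) = n \<and> dichromatic_number G = k}"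

section \<open>The $D_\alpha$ spectral radius\<close>

definition distance :: "('a, 'b) pre_digraph \<Rightarrow> 'a \<Rightarrow> 'a \<Rightarrow> nat" where
  "distance G u v = (LEAST l. \<exists>p. pre_digraph.apath G u p v \<and> length p = l)"

definition transmission :: "('a, 'b) pre_digraph \<Rightarrow> 'a \<Rightarrow> nat" where
  "transmission G u = (\<Sum>v\<in>verts G. distance G u v)"

text \<open>A list \<open>vs\<close> plays the role of the labelling $v_1,\dots,v_n$ of the vertices.\<close>

definition labelling :: "('a, 'b) pre_digraph \<Rightarrow> 'a list \<Rightarrow> bool" where
  "labelling G vs \<longleftrightarrow> distinct vs \<and> set vs = verts G"

definition distance_matrix :: "('a, 'b) pre_digraph \<Rightarrow> 'a list \<Rightarrow> real mat" where
  "distance_matrix G vs =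
     mat (length vs) (length vs) (\<lambda>(i, j). real (distance G (vs ! i) (vs ! j)))"

definition transmission_matrix :: "('a, 'b) pre_digraph \<Rightarrow> 'a list \<Rightarrow> real mat" where
  "transmission_matrix G vs = mat_diag (length vs) (\<lambda>i. real (transmission G (vs ! i)))"

definition D_alpha :: "real \<Rightarrow> ('a, 'b) pre_digraph \<Rightarrow> 'a list \<Rightarrow> real mat" where
  "D_alpha \<alpha> G vs = \<alpha> \<cdot>\<^sub>m transmission_matrix G vs + (1 - \<alpha>) \<cdot>\<^sub>m distance_matrix G vs"

text \<open>The spectral radius is the largest modulus of a complex eigenvalue. It is computed from some
  labelling; the lemma \<open>mu_alpha_labelling\<close> below shows that the choice is immaterial.\<close>

definition mu_alpha :: "real \<Rightarrow> ('a, 'b) pre_digraph \<Rightarrow> real" where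
  "mu_alpha \<alpha> G =
     spectral_radius (map_mat complex_of_real (D_alpha \<alpha> G (SOME vs. labelling G vs)))"

section \<open>Complete joins of transitive tournaments\<close>

definition tournament :: "('a, 'b) pre_digraph \<Rightarrow> bool" where
  "tournament G \<longleftrightarrow> digraph G \<and>
     (\<forall>u\<in>verts G. \<forall>v\<in>verts G. u \<noteq> v \<longrightarrow> (u \<rightarrow>\<^bsub>G\<^esub> v) \<noteq> (v \<rightarrow>\<^bsub>G\<^esub> u))"

definition transitive_tournament :: "('a, 'b) pre_digraph \<Rightarrow> bool" where
  "transitive_tournament G \<longleftrightarrow> tournament G \<and> out_degree G ` verts G = {0..<card (verts G)}"

definition transitive_join_partition :: "('a, 'b) pre_digraph \<Rightarrow> 'a set set \<Rightarrow> bool" where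
  "transitive_join_partition G P \<longleftrightarrow> partition_on (verts G) P \<and>
     (\<forall>V\<in>P. transitive_tournament (induce_subgraph G V)) \<and>
     (\<forall>V\<in>P. \<forall>W\<in>P. V \<noteq> W \<longrightarrow> (\<forall>u\<in>V. \<forall>v\<in>W. u \<rightarrow>\<^bsub>G\<^esub> v \<and> v \<rightarrow>\<^bsub>G\<^esub> u))"

definition transitive_join_class :: "nat \<Rightarrow> nat \<Rightarrow> ('a, 'b) pre_digraph set" where
  "transitive_join_class n k =
     {G. digraph G \<and> card (verts G) = n \<and> (\<exists>P. transitive_join_partition G P \<and> card P = k)}"

text \<open>The digraph $\mathcal{T}_n^{k*}$ is determined only up to isomorphism; it is represented by the set of
  all its copies.\<close>

definition balanced_transitive_joins :: "nat \<Rightarrow> nat \<Rightarrow> ('a, 'b) pre_digraph set" where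
  "balanced_transitive_joins n k =
     {G \<in> transitive_join_class n k. \<exists>P. transitive_join_partition G P \<and> card P = k \<and>
        (\<forall>V\<in>P. \<forall>W\<in>P. \<bar>int (card V) - int (card W)\<bar> \<le> 1)}"

section \<open>The library distance, and independence of the labelling\<close>

lemma (in fin_digraph) distance_eq_mu:
  assumes "u \<rightarrow>\<^sup>* v"
  shows "\<mu> (\<lambda>_. 1) u v = ereal (real (distance G u v))"
proof -
  have cost: "awalk_cost (\<lambda>_. 1) p = real (length p)" for p :: "'b list"
    by (simp add: awalk_cost_def sum_list_triv)
  obtain p where p: "apath u p v" "\<mu> (\<lambda>_. 1) u v = awalk_cost (\<lambda>_. 1) p"
    using min_cost_awalk[OF assms, of "\<lambda>_. 1"] by auto
  have "length p \<le> length q" if "apath u q v" for q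
  proof -
    have "\<mu> (\<lambda>_. 1) u v \<le> awalk_cost (\<lambda>_. 1) q"
      using that by (intro min_cost_le_walk_cost) (simp add: apath_def)
    then show ?thesis using p(2) by (simp add: cost)
  qed
  then have "distance G u v = length p"
    unfolding distance_def using p(1) by (intro Least_equality) auto
  then show ?thesis using p(2) by (simp add: cost)
qed

lemma labelling_exists:
  assumes "digraph G"
  shows "\<exists>vs. labelling G vs"
proof -
  interpret digraph G by fact
  show ?thesis using finite_distinct_list[OF finite_verts] by (auto simp: labelling_def)
qed

lemma D_alpha_index:
  assumes "i < length vs" "j < length vs"
  shows "D_alpha \<alpha> G vs $$ (i, j) =
    \<alpha> * (if i = j then real (transmission G (vs ! i)) else 0)
      + (1 - \<alpha>) * real (distance G (vs ! i) (vs ! j))"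
  using assms
  by (auto simp: D_alpha_def transmission_matrix_def distance_matrix_def mat_diag_def)

lemma D_alpha_dim [simp]:
  "D_alpha \<alpha> G vs \<in> carrier_mat (length vs) (length vs)"
  "dim_row (D_alpha \<alpha> G vs) = length vs" "dim_col (D_alpha \<alpha> G vs) = length vs"
  by (auto simp: D_alpha_def transmission_matrix_def distance_matrix_def mat_diag_def)

lemma eigenvalue_relabel:
  assumes vs: "labelling G vs" and ws: "labelling G ws"
    and ev: "eigenvalue (map_mat complex_of_real (D_alpha \<alpha> G vs)) k"
  shows "eigenvalue (map_mat complex_of_real (D_alpha \<alpha> G ws)) k"
proof -
  define n where "n = length vs"
  have len: "length ws = n"
    using vs ws by (metis labelling_def distinct_card n_def)
  define f where "f = (\<lambda>i. THE j. j < n \<and> vs ! j = ws ! i)"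
  have f: "f i < n \<and> vs ! f i = ws ! i" if "i < n" for i
  proof -
    have "ws ! i \<in> set vs" using that vs ws len by (metis labelling_def nth_mem)
    then have "\<exists>!j. j < n \<and> vs ! j = ws ! i"
      using vs unfolding labelling_def n_def by (metis in_set_conv_nth nth_eq_iff_index_eq)
    from theI'[OF this] show ?thesis by (simp add: f_def)
  qed
  have inj: "inj_on f {0..<n}"
    using f ws len by (intro inj_onI) (metis atLeastLessThan_iff labelling_def nth_eq_iff_index_eq)
  moreover have "f ` {0..<n} = {0..<n}" using f inj by (intro endo_inj_surj) auto
  ultimately have bij: "bij_betw f {0..<n} {0..<n}" by (simp add: bij_betw_def)
  let ?A = "map_mat complex_of_real (D_alpha \<alpha> G vs)"
  let ?B = "map_mat complex_of_real (D_alpha \<alpha> G ws)"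
  have AB: "?B $$ (i, j) = ?A $$ (f i, f j)" if "i < n" "j < n" for i j
  proof -
    have "i = j \<longleftrightarrow> f i = f j" using inj that by (auto simp: inj_on_def)
    then show ?thesis
      using that f[OF that(1)] f[OF that(2)] len by (auto simp: D_alpha_index n_def)
  qed
  from ev obtain x where x: "x \<in> carrier_vec n" "x \<noteq> 0\<^sub>v n" "?A *\<^sub>v x = k \<cdot>\<^sub>v x"
    by (auto simp: eigenvalue_def eigenvector_def n_def)
  define y where "y = vec n (\<lambda>i. x $ f i)"
  have "y \<noteq> 0\<^sub>v n"
  proof
    assume y0: "y = 0\<^sub>v n"
    have "x $ j = 0" if "j < n" for j
    proof -
      have "j \<in> f ` {0..<n}" using bij that by (simp add: bij_betw_def)
      then obtain i where "i < n" "f i = j" by auto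
      then show ?thesis using y0 by (metis index_vec index_zero_vec(1) y_def)
    qed
    then show False using x(1,2) by auto
  qed
  moreover have "?B *\<^sub>v y = k \<cdot>\<^sub>v y"
  proof (rule eq_vecI)
    fix i assume "i < dim_vec (k \<cdot>\<^sub>v y)"
    then have i: "i < n" by (simp add: y_def)
    have "(?B *\<^sub>v y) $ i = (\<Sum>j\<in>{0..<n}. ?B $$ (i, j) * y $ j)"
      using i len by (simp add: scalar_prod_def y_def)
    also have "\<dots> = (\<Sum>j\<in>{0..<n}. ?A $$ (f i, f j) * x $ f j)"
      using i AB by (intro sum.cong) (auto simp: y_def)
    also have "\<dots> = (\<Sum>j\<in>{0..<n}. ?A $$ (f i, j) * x $ j)"
      by (rule sum.reindex_bij_betw[OF bij])
    also have "\<dots> = (?A *\<^sub>v x) $ f i"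
      using f[OF i] x(1) by (simp add: scalar_prod_def n_def)
    also have "\<dots> = (k \<cdot>\<^sub>v y) $ i"
      using f[OF i] x i by (simp add: y_def)
    finally show "(?B *\<^sub>v y) $ i = (k \<cdot>\<^sub>v y) $ i" .
  qed (simp add: y_def len)
  ultimately show ?thesis
    by (auto simp: eigenvalue_def eigenvector_def len intro!: exI[of _ y]) (simp add: y_def)
qed

lemma mu_alpha_labelling:
  assumes "labelling G vs"
  shows "mu_alpha \<alpha> G = spectral_radius (map_mat complex_of_real (D_alpha \<alpha> G vs))"
proof -
  have "labelling G (SOME vs. labelling G vs)" by (rule someI[of _ vs]) fact
  then show ?thesis
    unfolding mu_alpha_def spectral_radius_def spectrum_def
    using assms eigenvalue_relabel by (metis (no_types, lifting) Collect_cong)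
qed

end

theory Submission
  imports Defs "HOL-Real_Asymp.Real_Asymp"
begin

text \<open>Let \<open>G\<close> be strongly connected of order \<open>n\<close>, split into \<open>k\<close> acyclic sets, and rank the vertices of each
set along a topological order. From a vertex to a different one the distance is at least 1, and it is
at least 2 if the target precedes the source in their common part, since then there is no arc. These
lower bounds are exactly the distances in the join of transitive tournaments on the same ranked parts
(for \<open>k \<ge> 2\<close>, a detour through another part has length 2). So the matrix \<open>D\<^sub>\<alpha>(G)\<close> dominates the matrix
of that join entry by entry, and if all distances agree then \<open>G\<close> is the join.

For a join with part sizes \<open>m\<^sub>1, \<dots>, m\<^sub>k\<close>, the matrix can be handled explicitly. With
\[ g_\theta(m) = \prod_{j<m} \Bigl(1 + \frac{1-\alpha}{\theta - \alpha j}\Bigr), \qquad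
   \mu = \theta + \alpha (n-1) - (1-\alpha), \]
the vector \<open>y\<close> that has entry \<open>g\<^sub>\<theta>(r+1) - g\<^sub>\<theta>(r)\<close> at each vertex of rank \<open>r\<close> satisfies
\[ D_\alpha y = \mu y + (1-\alpha) \Bigl(\sum_i (g_\theta(m_i) - 1) - 1\Bigr) \mathbf{1} \]
(\<open>join_matrix_row\<close>). By the intermediate value theorem some \<open>\<theta>\<close>, large enough to make \<open>y\<close> positive, annihilates
the last term for the part sizes of \<open>G\<close> (\<open>growth_root_exists\<close>); \<open>\<mu>\<close> is then the spectral radius of the
join below \<open>G\<close>.

For this same \<open>\<theta>\<close> the function \<open>g\<^sub>\<theta>\<close> is strictly convex in the size, so that \<open>\<Sum>\<^sub>i g\<^sub>\<theta>(m\<^sub>i)\<close> is smallest for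
balanced sizes, and only for these (\<open>balanced_sizes_minimise_convex_sum\<close>). On the balanced join \<open>T\<close> the
analogous vector \<open>y'\<close> therefore has \<open>D\<^sub>\<alpha>(T) y' \<le> \<mu> y'\<close>, while \<open>D\<^sub>\<alpha>(G) y \<ge> \<mu> y\<close>. The bounds of
Collatz--Wielandt type in the first part turn this into \<open>\<mu>\<^sub>\<alpha>(T) \<le> \<mu> \<le> \<mu>\<^sub>\<alpha>(G)\<close>. The first inequality is
strict if the parts of \<open>G\<close> are not balanced, the second if some distance in \<open>G\<close> exceeds its lower bound.
In the case of equality \<open>G\<close> is thus a join with balanced parts, and a rank-preserving bijection between
parts of equal size is an isomorphism onto \<open>T\<close>.\<close>

section \<open>Collatz--Wielandt bounds for the spectral radius\<close>

text \<open>An eigenvector \<open>x\<close> is compared with \<open>y\<close> at an index where \<open>\<bar>x\<^sub>i\<bar> / y\<^sub>i\<close> is largest.\<close>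

lemma spectral_radius_le_of_subinvariant:
  fixes A :: "real mat" and y :: "nat \<Rightarrow> real"
  assumes A: "A \<in> carrier_mat n n" and n: "0 < n"
    and nonneg: "\<And>i j. i < n \<Longrightarrow> j < n \<Longrightarrow> 0 \<le> A $$ (i, j)"
    and y: "\<And>i. i < n \<Longrightarrow> 0 < y i"
    and le: "\<And>i. i < n \<Longrightarrow> (\<Sum>j<n. A $$ (i, j) * y j) \<le> \<mu> * y i"
  shows "spectral_radius (map_mat complex_of_real A) \<le> \<mu>"
proof -
  let ?B = "map_mat complex_of_real A"
  have B: "?B \<in> carrier_mat n n" using A by simp
  obtain z where ev: "eigenvalue ?B z" and r: "spectral_radius ?B = cmod z"
    using spectral_radius_mem_max(1)[OF B n] by (auto simp: spectrum_def)
  from ev obtain x where x: "x \<in> carrier_vec n" "x \<noteq> 0\<^sub>v n" "?B *\<^sub>v x = z \<cdot>\<^sub>v x"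
    using A by (auto simp: eigenvalue_def eigenvector_def)
  define t where "t = Max ((\<lambda>i. cmod (x $ i) / y i) ` {..<n})"
  have fin: "finite ((\<lambda>i. cmod (x $ i) / y i) ` {..<n})"
    and ne: "(\<lambda>i. cmod (x $ i) / y i) ` {..<n} \<noteq> {}" using n by auto
  have t: "cmod (x $ j) \<le> t * y j" if "j < n" for j
  proof -
    have "cmod (x $ j) / y j \<le> t" unfolding t_def using that fin by (intro Max_ge) auto
    then show ?thesis using y[OF that] by (simp add: divide_le_eq)
  qed
  obtain i where i: "i < n" "t = cmod (x $ i) / y i"
    using Max_in[OF fin ne] by (auto simp: t_def)
  have ti: "cmod (x $ i) = t * y i" using i y[OF i(1)] by simp
  have t0: "0 < t"
  proof (rule ccontr)
    assume "\<not> 0 < t"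
    then have "cmod (x $ j) \<le> 0" if "j < n" for j
      using t[OF that] y[OF that] by (smt (verit) mult_nonneg_nonneg mult_minus_left)
    then have "x = 0\<^sub>v n" using x(1) by (intro eq_vecI) auto
    then show False using x(2) by simp
  qed
  have "cmod z * (t * y i) = cmod ((?B *\<^sub>v x) $ i)"
    using x i(1) by (simp add: norm_mult ti)
  also have "(?B *\<^sub>v x) $ i = (\<Sum>j<n. complex_of_real (A $$ (i, j)) * x $ j)"
    using A x(1) i(1) by (simp add: scalar_prod_def atLeast0LessThan)
  also have "cmod \<dots> \<le> (\<Sum>j<n. A $$ (i, j) * (t * y j))"
    using i(1) nonneg t by (intro sum_norm_le) (auto simp: norm_mult intro!: mult_left_mono)
  also have "\<dots> = t * (\<Sum>j<n. A $$ (i, j) * y j)"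
    by (simp add: sum_distrib_left mult_ac)
  also have "\<dots> \<le> t * (\<mu> * y i)" using le[OF i(1)] t0 by simp
  finally have "cmod z * (t * y i) \<le> \<mu> * (t * y i)" by (simp add: mult_ac)
  then have "cmod z \<le> \<mu>" using t0 y[OF i(1)] by simp
  then show ?thesis by (simp add: r)
qed

lemma spectral_radius_smult_less_1:
  fixes B :: "complex mat"
  assumes B: "B \<in> carrier_mat n n" and n: "0 < n" and "0 < \<nu>" and less: "spectral_radius B < \<nu>"
  shows "spectral_radius (complex_of_real (1 / \<nu>) \<cdot>\<^sub>m B) < 1"
proof -
  let ?C = "complex_of_real (1 / \<nu>) \<cdot>\<^sub>m B"
  have C: "?C \<in> carrier_mat n n" using B by simp
  obtain z where ev: "eigenvalue ?C z" and r: "spectral_radius ?C = cmod z"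
    using spectral_radius_mem_max(1)[OF C n] by (auto simp: spectrum_def)
  from ev obtain x where x: "x \<in> carrier_vec n" "x \<noteq> 0\<^sub>v n" "?C *\<^sub>v x = z \<cdot>\<^sub>v x"
    using B by (auto simp: eigenvalue_def eigenvector_def)
  have "B *\<^sub>v x = (complex_of_real \<nu> * z) \<cdot>\<^sub>v x"
  proof (rule eq_vecI)
    fix i assume "i < dim_vec ((complex_of_real \<nu> * z) \<cdot>\<^sub>v x)"
    then have i: "i < n" using x by simp
    have "(?C *\<^sub>v x) $ i = complex_of_real (1 / \<nu>) * (B *\<^sub>v x) $ i"
      using i B x(1) by (simp add: scalar_prod_def sum_distrib_left mult_ac)
    then have "complex_of_real \<nu> * (z * x $ i) = (B *\<^sub>v x) $ i"
      using x i \<open>0 < \<nu>\<close> by simp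
    then show "(B *\<^sub>v x) $ i = ((complex_of_real \<nu> * z) \<cdot>\<^sub>v x) $ i"
      using x(1) i by (simp add: mult.assoc)
  qed (use B x in simp)
  then have "eigenvalue B (complex_of_real \<nu> * z)"
    using x B by (auto simp: eigenvalue_def eigenvector_def intro!: exI[of _ x])
  then have "cmod (complex_of_real \<nu> * z) \<le> spectral_radius B"
    by (intro spectral_radius_mem_max(2)[OF B n]) (auto simp: spectrum_def)
  then have "\<nu> * cmod z \<le> spectral_radius B" using \<open>0 < \<nu>\<close> by (simp add: norm_mult)
  then have "\<nu> * cmod z < \<nu> * 1" using less by linarith
  then show ?thesis using \<open>0 < \<nu>\<close> unfolding r by (simp only: mult_less_cancel_left_pos)
qed

text \<open>If the spectral radius were below \<open>\<mu>\<close>, the matrix could be divided by some \<open>\<nu> < \<mu>\<close> that still exceeds the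
spectral radius. The powers of the quotient are bounded because its spectral radius is below 1, yet applied to \<open>y\<close>
they grow at least like \<open>(\<mu> / \<nu>)\<^sup>k\<close>.\<close>

lemma spectral_radius_ge_of_superinvariant:
  fixes A :: "real mat" and y :: "nat \<Rightarrow> real"
  assumes A: "A \<in> carrier_mat n n" and n: "0 < n"
    and nonneg: "\<And>i j. i < n \<Longrightarrow> j < n \<Longrightarrow> 0 \<le> A $$ (i, j)"
    and y: "\<And>i. i < n \<Longrightarrow> 0 < y i"
    and ge: "\<And>i. i < n \<Longrightarrow> \<mu> * y i \<le> (\<Sum>j<n. A $$ (i, j) * y j)"
  shows "\<mu> \<le> spectral_radius (map_mat complex_of_real A)"
proof (rule ccontr)
  let ?B = "map_mat complex_of_real A"
  assume "\<not> ?thesis"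
  moreover have B: "?B \<in> carrier_mat n n" using A by simp
  moreover have "0 \<le> spectral_radius ?B"
    using spectral_radius_mem_max(1)[OF B n] by auto
  ultimately obtain \<nu> where \<nu>: "spectral_radius ?B < \<nu>" "\<nu> < \<mu>" "0 < \<nu>"
    by (metis dense dual_order.strict_trans1 linorder_not_le)
  define C where "C = complex_of_real (1 / \<nu>) \<cdot>\<^sub>m ?B"
  have C: "C \<in> carrier_mat n n" using A by (simp add: C_def)
  obtain b where b: "\<And>k. norm_bound (C ^\<^sub>m k) b"
    using spectral_radius_jnf_norm_bound_less_1_upper_triangular[OF C]
      spectral_radius_smult_less_1[OF B n \<nu>(3,1)] by (auto simp: C_def)
  define w where "w = vec n (\<lambda>i. complex_of_real (y i))"
  have w: "w \<in> carrier_vec n" by (simp add: w_def)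
  define q where "q = \<mu> / \<nu>"
  have q: "1 < q" using \<nu> by (simp add: q_def)
  \<comment> \<open>The real vector \<open>r\<close> records that the iterates of the complex matrix stay real.\<close>
  have grow: "\<exists>r. (C ^\<^sub>m k *\<^sub>v w) = vec n (\<lambda>i. complex_of_real (r i)) \<and> (\<forall>i<n. q ^ k * y i \<le> r i)" for k
  proof (induction k)
    case 0
    show ?case using C w by (intro exI[of _ y]) (auto simp: w_def)
  next
    case (Suc k)
    then obtain r where r: "C ^\<^sub>m k *\<^sub>v w = vec n (\<lambda>i. complex_of_real (r i))"
      "\<And>i. i < n \<Longrightarrow> q ^ k * y i \<le> r i" by auto
    have "C ^\<^sub>m Suc k *\<^sub>v w = C *\<^sub>v (C ^\<^sub>m k *\<^sub>v w)"
    proof -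
      have "C ^\<^sub>m Suc k = C * C ^\<^sub>m k"
      proof (induction k)
        case (Suc k)
        then have "C ^\<^sub>m Suc (Suc k) = (C * C ^\<^sub>m k) * C" by simp
        also have "\<dots> = C * (C ^\<^sub>m k * C)" using C by (intro assoc_mult_mat) auto
        finally show ?case by simp
      qed (use C in simp)
      then show ?thesis using C w assoc_mult_mat_vec[OF C pow_carrier_mat[OF C] w] by simp
    qed
    moreover have "C *\<^sub>v (C ^\<^sub>m k *\<^sub>v w) = vec n (\<lambda>i. complex_of_real (\<Sum>j<n. A $$ (i, j) * r j / \<nu>))"
      unfolding r(1) using A by (intro eq_vecI) (auto simp: C_def scalar_prod_def atLeast0LessThan)
    moreover have "q ^ Suc k * y i \<le> (\<Sum>j<n. A $$ (i, j) * r j / \<nu>)" if "i < n" for i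
    proof -
      have "q ^ Suc k * y i = q ^ k * (\<mu> * y i) / \<nu>" by (simp add: q_def)
      also have "\<dots> \<le> q ^ k * (\<Sum>j<n. A $$ (i, j) * y j) / \<nu>"
        using ge[OF that] q \<nu>(3) by (intro divide_right_mono mult_left_mono) auto
      also have "\<dots> = (\<Sum>j<n. A $$ (i, j) * (q ^ k * y j) / \<nu>)"
        by (simp add: sum_distrib_left sum_divide_distrib mult_ac)
      also have "\<dots> \<le> (\<Sum>j<n. A $$ (i, j) * r j / \<nu>)"
        using that nonneg r(2) \<nu>(3) by (intro sum_mono divide_right_mono mult_left_mono) auto
      finally show ?thesis .
    qed
    ultimately show ?case
      by (intro exI[of _ "\<lambda>i. \<Sum>j<n. A $$ (i, j) * r j / \<nu>"]) auto
  qed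
  have bound: "q ^ k * y 0 \<le> (\<Sum>j<n. b * y j)" for k
  proof -
    obtain r where r: "C ^\<^sub>m k *\<^sub>v w = vec n (\<lambda>i. complex_of_real (r i))" "q ^ k * y 0 \<le> r 0"
      using grow[of k] n by auto
    have Ck: "C ^\<^sub>m k \<in> carrier_mat n n" using C by simp
    have "complex_of_real (r 0) = (C ^\<^sub>m k *\<^sub>v w) $ 0" using r(1) n by simp
    also have "\<dots> = (\<Sum>j<n. (C ^\<^sub>m k) $$ (0, j) * complex_of_real (y j))"
      using n C by (simp add: scalar_prod_def w_def atLeast0LessThan)
    finally have "\<bar>r 0\<bar> = cmod \<dots>" by (metis norm_of_real)
    also have "\<dots> \<le> (\<Sum>j<n. b * y j)"
    proof (intro sum_norm_le)
      fix j assume "j \<in> {..<n}"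
      then have j: "j < n" by simp
      have "cmod ((C ^\<^sub>m k) $$ (0, j)) \<le> b" using b[of k] j n C by (auto simp: norm_bound_def split: if_splits)
      then show "cmod ((C ^\<^sub>m k) $$ (0, j) * complex_of_real (y j)) \<le> b * y j"
        using y[OF j] by (simp add: norm_mult)
    qed
    finally show ?thesis using r(2) by simp
  qed
  obtain k where "(\<Sum>j<n. b * y j) / y 0 < q ^ k"
    using real_arch_pow[OF q] by blast
  then show False using bound[of k] y[OF n] by (simp add: divide_less_eq)
qed

text \<open>Write \<open>w = A y - \<mu> y\<close>, which is nonnegative and nonzero. All off-diagonal entries of \<open>A\<close> are positive, so \<open>(A + I) w\<close> is
positive everywhere; it equals \<open>A y' - \<mu> y'\<close> for \<open>y' = (A + I) y\<close>. Hence \<open>y'\<close> is superinvariant even for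
a slightly larger \<open>\<mu>\<close>.\<close>

lemma spectral_radius_gt_of_superinvariant:
  fixes A :: "real mat" and y :: "nat \<Rightarrow> real"
  assumes A: "A \<in> carrier_mat n n"
    and nonneg: "\<And>i j. i < n \<Longrightarrow> j < n \<Longrightarrow> 0 \<le> A $$ (i, j)"
    and pos: "\<And>i j. i < n \<Longrightarrow> j < n \<Longrightarrow> i \<noteq> j \<Longrightarrow> 0 < A $$ (i, j)"
    and y: "\<And>i. i < n \<Longrightarrow> 0 < y i"
    and ge: "\<And>i. i < n \<Longrightarrow> \<mu> * y i \<le> (\<Sum>j<n. A $$ (i, j) * y j)"
    and m: "m < n" and gt: "\<mu> * y m < (\<Sum>j<n. A $$ (m, j) * y j)"
  shows "\<mu> < spectral_radius (map_mat complex_of_real A)"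
proof -
  define w where "w i = (\<Sum>j<n. A $$ (i, j) * y j) - \<mu> * y i" for i
  define y' where "y' i = (\<Sum>j<n. A $$ (i, j) * y j) + y i" for i
  have w0: "0 \<le> w i" if "i < n" for i using ge[OF that] by (simp add: w_def)
  have wm: "0 < w m" using gt by (simp add: w_def)
  have y': "0 < y' i" if "i < n" for i
    unfolding y'_def using that y nonneg
    by (intro add_nonneg_pos sum_nonneg mult_nonneg_nonneg) (auto intro: less_imp_le)
  have gap: "(\<Sum>j<n. A $$ (i, j) * y' j) - \<mu> * y' i = (\<Sum>j<n. A $$ (i, j) * w j) + w i" for i
    by (simp add: y'_def w_def algebra_simps sum.distrib sum_subtractf sum_distrib_left)
  have gap_pos: "0 < (\<Sum>j<n. A $$ (i, j) * w j) + w i" if i: "i < n" for i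
  proof (cases "i = m")
    case True
    then show ?thesis using i wm w0 nonneg by (intro add_nonneg_pos sum_nonneg) auto
  next
    case False
    have "0 < A $$ (i, m) * w m" using pos[OF i m False] wm by simp
    also have "\<dots> \<le> (\<Sum>j<n. A $$ (i, j) * w j)"
      using m i w0 nonneg by (intro member_le_sum) auto
    finally show ?thesis using w0[OF i] by simp
  qed
  define \<epsilon> where "\<epsilon> = Min ((\<lambda>i. ((\<Sum>j<n. A $$ (i, j) * w j) + w i) / y' i) ` {..<n})"
  have "0 < \<epsilon>" unfolding \<epsilon>_def using m gap_pos y' by (subst Min_gr_iff) auto
  moreover have "\<mu> + \<epsilon> \<le> spectral_radius (map_mat complex_of_real A)"
  proof (rule spectral_radius_ge_of_superinvariant[OF A _ nonneg y'])
    fix i assume i: "i < n"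
    have "\<epsilon> \<le> ((\<Sum>j<n. A $$ (i, j) * w j) + w i) / y' i"
      unfolding \<epsilon>_def using i by (intro Min_le) auto
    then have "\<epsilon> * y' i \<le> (\<Sum>j<n. A $$ (i, j) * w j) + w i"
      using y'[OF i] by (simp add: le_divide_eq)
    then show "(\<mu> + \<epsilon>) * y' i \<le> (\<Sum>j<n. A $$ (i, j) * y' j)"
      using gap[of i] by (simp add: algebra_simps)
  qed (use m in auto)
  ultimately show ?thesis by simp
qed

lemma spectral_radius_less_of_subinvariant:
  fixes A :: "real mat" and y :: "nat \<Rightarrow> real"
  assumes A: "A \<in> carrier_mat n n" and n: "0 < n"
    and nonneg: "\<And>i j. i < n \<Longrightarrow> j < n \<Longrightarrow> 0 \<le> A $$ (i, j)"
    and y: "\<And>i. i < n \<Longrightarrow> 0 < y i"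
    and less: "\<And>i. i < n \<Longrightarrow> (\<Sum>j<n. A $$ (i, j) * y j) < \<mu> * y i"
  shows "spectral_radius (map_mat complex_of_real A) < \<mu>"
proof -
  define \<nu> where "\<nu> = Max ((\<lambda>i. (\<Sum>j<n. A $$ (i, j) * y j) / y i) ` {..<n})"
  have "spectral_radius (map_mat complex_of_real A) \<le> \<nu>"
  proof (rule spectral_radius_le_of_subinvariant[OF A n nonneg y])
    fix i assume i: "i < n"
    have "(\<Sum>j<n. A $$ (i, j) * y j) / y i \<le> \<nu>" unfolding \<nu>_def using i by (intro Max_ge) auto
    then show "(\<Sum>j<n. A $$ (i, j) * y j) \<le> \<nu> * y i" using y[OF i] by (simp add: divide_le_eq)
  qed auto
  also have "\<nu> < \<mu>" unfolding \<nu>_def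
    using n y less by (subst Max_less_iff) (auto simp: divide_less_eq)
  finally show ?thesis .
qed



section \<open>Balanced sizes and convex sums\<close>

text \<open>A strictly convex sequence lies above the line through its values at \<open>q\<close> and \<open>q + 1\<close>, and meets it only there.
Convexity is assumed only up to a bound \<open>M\<close>: the function to which this is applied is convex before its
first pole.\<close>

lemma discrete_tangent_line:
  fixes g :: "nat \<Rightarrow> real"
  assumes convex: "\<And>m. Suc (Suc m) \<le> M \<Longrightarrow> g (Suc m) - g m < g (Suc (Suc m)) - g (Suc m)"
    and q: "q < M" and m: "m \<le> M"
  defines "line \<equiv> \<lambda>x. g q + (g (Suc q) - g q) * (real x - real q)"
  shows "line m \<le> g m" and "m \<notin> {q, Suc q} \<Longrightarrow> line m < g m"
proof -
  have inc: "g (Suc i) - g i < g (Suc j) - g j" if "i < j" "j < M" for i j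
    using that
  proof (induction j)
    case (Suc j)
    then show ?case using convex[of j] by (cases "i = j") auto
  qed simp
  have line_Suc: "line (Suc x) = line x + (g (Suc q) - g q)" for x
    by (simp add: line_def algebra_simps)
  have line_q: "line q = g q" "line (Suc q) = g (Suc q)" by (simp_all add: line_def)
  have above: "line (Suc q + d) \<le> g (Suc q + d) \<and> (0 < d \<longrightarrow> line (Suc q + d) < g (Suc q + d))"
    if "Suc q + d \<le> M" for d
    using that
  proof (induction d)
    case (Suc d)
    then show ?case using inc[of q "Suc q + d"] line_Suc[of "Suc q + d"] by auto
  qed (simp add: line_q)
  have below: "line (q - d) \<le> g (q - d) \<and> (0 < d \<longrightarrow> line (q - d) < g (q - d))"
    if "d \<le> q" for d
    using that
  proof (induction d)
    case (Suc d)
    moreover have "Suc (q - Suc d) = q - d" using Suc.prems by simp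
    ultimately show ?case using inc[of "q - Suc d" q] line_Suc[of "q - Suc d"] q by auto
  qed (simp add: line_q)
  show "line m \<le> g m"
    using above[of "m - Suc q"] below[of "q - m"] m by (cases "m \<le> q") auto
  show "line m < g m" if "m \<notin> {q, Suc q}"
    using above[of "m - Suc q"] below[of "q - m"] m that by (cases "m \<le> q") auto
qed

text \<open>The balanced sizes all lie in \<open>{q, q + 1}\<close>, where \<open>g\<close> coincides with its secant line there. The sum of
the values on that line depends only on the number of parts and on the total, so that it is the same for \<open>s\<close> and
\<open>t\<close>. The bound \<open>t i \<le> M\<close> shows that the balanced sizes stay within the range of convexity.\<close>

lemma balanced_sizes_minimise_convex_sum:
  fixes g :: "nat \<Rightarrow> real" and s :: "'p \<Rightarrow> nat" and t :: "'q \<Rightarrow> nat"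
  assumes fin: "finite P" "finite Q" and cards: "card P = card Q" and ne: "Q \<noteq> {}"
    and total: "sum s P = sum t Q"
    and balanced: "\<And>i j. i \<in> Q \<Longrightarrow> j \<in> Q \<Longrightarrow> t i \<le> Suc (t j)"
    and bound: "\<And>i. i \<in> P \<Longrightarrow> s i \<le> M"
    and convex: "\<And>m. Suc (Suc m) \<le> M \<Longrightarrow> g (Suc m) - g m < g (Suc (Suc m)) - g (Suc m)"
  shows "\<And>i. i \<in> Q \<Longrightarrow> t i \<le> M"
    and "(\<Sum>i\<in>Q. g (t i)) \<le> (\<Sum>i\<in>P. g (s i))"
    and "(\<Sum>i\<in>Q. g (t i)) = (\<Sum>i\<in>P. g (s i)) \<Longrightarrow>
      \<exists>q. (\<forall>i\<in>P. s i \<in> {q, Suc q}) \<and> (\<forall>i\<in>Q. t i \<in> {q, Suc q})"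
proof -
  have s_le: "sum s P \<le> card Q * M"
    using sum_bounded_above[of P s M] bound cards by simp
  show t_le: "t i \<le> M" if i: "i \<in> Q" for i
  proof (rule ccontr)
    assume "\<not> t i \<le> M"
    then have "\<And>j. j \<in> Q \<Longrightarrow> M \<le> t j" "M < t i" using balanced[OF i] by fastforce+
    then have "(\<Sum>j\<in>Q. M) < sum t Q" using fin(2) i by (intro sum_strict_mono_ex1) auto
    then show False using s_le total by simp
  qed
  define q where "q = Min (t ` Q)"
  have q_le: "q \<le> t i" if "i \<in> Q" for i using that fin by (simp add: q_def)
  have "q \<in> t ` Q" unfolding q_def using fin ne by (intro Min_in) auto
  then have t_q: "t i \<in> {q, Suc q}" if "i \<in> Q" for i
    using q_le[OF that] balanced[OF that] by fastforce
  \<comment> \<open>If \<open>M \<le> q\<close>, the secant at \<open>q\<close> would leave the range of convexity, but then all sizes equal \<open>M\<close>.\<close>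
  have "(\<Sum>i\<in>Q. g (t i)) \<le> (\<Sum>i\<in>P. g (s i)) \<and>
    ((\<Sum>i\<in>Q. g (t i)) = (\<Sum>i\<in>P. g (s i)) \<longrightarrow> (\<forall>i\<in>P. s i \<in> {q, Suc q}))"
  proof (cases "q < M")
    case True
    define line where "line = (\<lambda>x. g q + (g (Suc q) - g q) * (real x - real q))"
    have line_sum: "(\<Sum>i\<in>A. line (f i)) = real (card A) * (g q - (g (Suc q) - g q) * real q)
        + (g (Suc q) - g q) * real (sum f A)" for A and f :: "'z \<Rightarrow> nat"
      by (simp add: line_def algebra_simps sum.distrib sum_subtractf sum_distrib_left)
    have lines: "(\<Sum>i\<in>Q. line (t i)) = (\<Sum>i\<in>P. line (s i))"
      by (simp only: line_sum cards total)
    have tg: "g (t i) = line (t i)" if "i \<in> Q" for i using t_q[OF that] by (auto simp: line_def)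
    have sg: "line (s i) \<le> g (s i)" "s i \<notin> {q, Suc q} \<Longrightarrow> line (s i) < g (s i)" if "i \<in> P" for i
      using discrete_tangent_line[where g = g and M = M and m = "s i", OF convex True bound[OF that]] by (simp_all add: line_def)
    have strict: "(\<Sum>i\<in>P. line (s i)) < (\<Sum>i\<in>P. g (s i))" if "\<not> (\<forall>i\<in>P. s i \<in> {q, Suc q})"
      using that fin sg by (intro sum_strict_mono_ex1) blast+
    have "(\<Sum>i\<in>P. line (s i)) \<le> (\<Sum>i\<in>P. g (s i))" by (intro sum_mono sg)
    moreover have "(\<Sum>i\<in>Q. g (t i)) = (\<Sum>i\<in>P. line (s i))" using lines tg by simp
    ultimately show ?thesis using strict by (metis less_irrefl)
  next
    case False
    then have t_M: "t i = M" if "i \<in> Q" for i using t_le[OF that] q_le[OF that] by simp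
    have s_M: "s i = M" if "i \<in> P" for i
    proof (rule ccontr)
      assume "s i \<noteq> M"
      then have "s i < M" using bound[OF that] by simp
      then have "sum s P < (\<Sum>i\<in>P. M)" using fin that bound by (intro sum_strict_mono_ex1) auto
      then show False using total t_M cards by simp
    qed
    have "q = M" using t_M ne False \<open>q \<in> t ` Q\<close> by auto
    then show ?thesis using t_M s_M cards by simp
  qed
  then show "(\<Sum>i\<in>Q. g (t i)) \<le> (\<Sum>i\<in>P. g (s i))"
    and "(\<Sum>i\<in>Q. g (t i)) = (\<Sum>i\<in>P. g (s i)) \<Longrightarrow>
      \<exists>q. (\<forall>i\<in>P. s i \<in> {q, Suc q}) \<and> (\<forall>i\<in>Q. t i \<in> {q, Suc q})"
    using t_q by auto
qed

text \<open>The total and the number of parts determine how many parts have size \<open>q + 1\<close>.\<close>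

lemma size_preserving_bijection_of_balanced:
  fixes s :: "'p \<Rightarrow> nat" and t :: "'q \<Rightarrow> nat"
  assumes fin: "finite P" "finite Q" and cards: "card P = card Q" and total: "sum s P = sum t Q"
    and s: "\<And>i. i \<in> P \<Longrightarrow> s i \<in> {q, Suc q}" and t: "\<And>i. i \<in> Q \<Longrightarrow> t i \<in> {q, Suc q}"
  obtains \<beta> where "bij_betw \<beta> P Q" and "\<And>i. i \<in> P \<Longrightarrow> t (\<beta> i) = s i"
proof -
  have count: "sum f A = card A * q + card {i \<in> A. f i = Suc q}"
    if "finite A" "\<And>i. i \<in> A \<Longrightarrow> f i \<in> {q, Suc q}" for A and f :: "'z \<Rightarrow> nat"
  proof -
    have "sum f A = (\<Sum>i\<in>A. q + of_bool (f i = Suc q))" using that(2) by (intro sum.cong) fastforce+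
    then show ?thesis using that(1) by (simp add: sum.distrib Int_def)
  qed
  let ?P = "{i \<in> P. s i = Suc q}" and ?Q = "{i \<in> Q. t i = Suc q}"
  have big: "card ?P = card ?Q" using count[OF fin(1) s] count[OF fin(2) t] cards total by simp
  have "card (P - ?P) = card (Q - ?Q)" using big cards fin by (simp add: card_Diff_subset)
  then obtain h where h: "bij_betw h (P - ?P) (Q - ?Q)"
    using finite_same_card_bij[of "P - ?P" "Q - ?Q"] fin by auto
  obtain f where f: "bij_betw f ?P ?Q"
    using finite_same_card_bij[of ?P ?Q] fin big by auto
  define \<beta> where "\<beta> i = (if i \<in> ?P then f i else h i)" for i
  have "bij_betw \<beta> (?P \<union> (P - ?P)) (?Q \<union> (Q - ?Q))"
    using f h unfolding \<beta>_def by (intro bij_betw_disjoint_Un) auto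
  moreover have "?P \<union> (P - ?P) = P" "?Q \<union> (Q - ?Q) = Q" by auto
  ultimately have "bij_betw \<beta> P Q" by simp
  moreover have "t (\<beta> i) = s i" if i: "i \<in> P" for i
  proof (cases "i \<in> ?P")
    case True
    then show ?thesis using bij_betwE[OF f] by (auto simp: \<beta>_def)
  next
    case False
    then have "h i \<in> Q - ?Q" using bij_betwE[OF h] i by auto
    then show ?thesis using False i s[OF i] t[of "h i"] by (auto simp: \<beta>_def)
  qed
  ultimately show ?thesis by (rule that)
qed

section \<open>Perron vectors of joins of transitive tournaments\<close>

text \<open>In a join, let \<open>S\<close> be the sum of all entries of an eigenvector for \<open>\<mu> = \<theta> + \<alpha> (n - 1) - (1 - \<alpha>)\<close>. The eigenvalue
equation at the vertex of rank \<open>j\<close> gives its entry as \<open>(1 - \<alpha>) / (\<theta> - \<alpha> j)\<close> times the sum of \<open>S\<close> and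
the entries that precede it in its part. Each vertex thus multiplies this running sum by
\<open>1 + (1 - \<alpha>) / (\<theta> - \<alpha> j)\<close>; for \<open>S = 1\<close>, \<open>growth \<alpha> \<theta> m\<close> is the sum after \<open>m\<close> vertices.\<close>

definition growth :: "real \<Rightarrow> real \<Rightarrow> nat \<Rightarrow> real" where
  "growth \<alpha> \<theta> m = (\<Prod>j<m. 1 + (1 - \<alpha>) / (\<theta> - \<alpha> * real j))"

text \<open>The entry at rank \<open>j\<close> of the vector that is normalised by \<open>S = 1\<close>.\<close>

definition weight :: "real \<Rightarrow> real \<Rightarrow> nat \<Rightarrow> real" where
  "weight \<alpha> \<theta> j = growth \<alpha> \<theta> (Suc j) - growth \<alpha> \<theta> j"

lemma growth_0 [simp]: "growth \<alpha> \<theta> 0 = 1"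
  by (simp add: growth_def)

lemma growth_ge_1:
  assumes "\<alpha> < 1" and "\<And>j. j < m \<Longrightarrow> \<alpha> * real j < \<theta>"
  shows "1 \<le> growth \<alpha> \<theta> m"
  unfolding growth_def using assms by (intro prod_ge_1) (auto intro!: divide_nonneg_pos)

lemma weight_eq: "weight \<alpha> \<theta> j = growth \<alpha> \<theta> j * ((1 - \<alpha>) / (\<theta> - \<alpha> * real j))"
  by (simp add: weight_def growth_def algebra_simps)

lemma sum_weight: "(\<Sum>j<m. weight \<alpha> \<theta> j) = growth \<alpha> \<theta> m - 1"
  unfolding weight_def by (subst sum_lessThan_telescope) simp

lemma weight_pos:
  assumes "\<alpha> < 1" and "\<And>i. i \<le> j \<Longrightarrow> \<alpha> * real i < \<theta>"
  shows "0 < weight \<alpha> \<theta> j"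
proof -
  have "1 \<le> growth \<alpha> \<theta> j" using assms by (intro growth_ge_1) auto
  then show ?thesis using assms(1) assms(2)[of j] by (simp add: weight_eq)
qed

text \<open>The increment at \<open>m\<close> is \<open>growth \<alpha> \<theta> m\<close>, which increases strictly, times \<open>(1 - \<alpha>) / (\<theta> - \<alpha> m)\<close>, which
does not decrease before the pole.\<close>

lemma growth_strictly_convex:
  assumes "0 \<le> \<alpha>" "\<alpha> < 1" and valid: "\<And>j. j < Suc (Suc m) \<Longrightarrow> \<alpha> * real j < \<theta>"
  shows "growth \<alpha> \<theta> (Suc m) - growth \<alpha> \<theta> m < growth \<alpha> \<theta> (Suc (Suc m)) - growth \<alpha> \<theta> (Suc m)"
proof -
  have "0 < weight \<alpha> \<theta> m" using assms by (intro weight_pos) auto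
  then have "growth \<alpha> \<theta> m < growth \<alpha> \<theta> (Suc m)" by (simp add: weight_def)
  moreover have "(1 - \<alpha>) / (\<theta> - \<alpha> * real m) \<le> (1 - \<alpha>) / (\<theta> - \<alpha> * real (Suc m))"
    using assms(1,2) valid[of "Suc m"] by (intro frac_le) (auto intro!: mult_left_mono)
  moreover have "0 < (1 - \<alpha>) / (\<theta> - \<alpha> * real m)" using assms(2) valid[of m] by simp
  moreover have "1 \<le> growth \<alpha> \<theta> m" using assms by (intro growth_ge_1) auto
  ultimately have "weight \<alpha> \<theta> m < weight \<alpha> \<theta> (Suc m)"
    unfolding weight_eq by (intro mult_less_le_imp_less) auto
  then show ?thesis by (simp add: weight_def)
qed

text \<open>The equation says that the normalised vector has sum 1, which is what makes it an eigenvector. Its left side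
tends to 0 as \<open>\<theta>\<close> tends to infinity. It is at least 1 at \<open>\<theta> = \<alpha> (M - 1) + (1 - \<alpha>)\<close> with \<open>M\<close> the largest size,
because there the last factor for a largest part equals 2.\<close>

lemma growth_root_exists:
  fixes s :: "'p \<Rightarrow> nat"
  assumes \<alpha>: "0 \<le> \<alpha>" "\<alpha> < 1" and fin: "finite P" and F: "F \<in> P" "0 < s F"
  obtains \<theta> where "\<And>j. j < Max (s ` P) \<Longrightarrow> \<alpha> * real j < \<theta>"
    and "(\<Sum>F\<in>P. growth \<alpha> \<theta> (s F) - 1) = 1"
proof -
  define M where "M = Max (s ` P)"
  have s_le: "s G \<le> M" if "G \<in> P" for G using that fin by (simp add: M_def)
  have "M \<in> s ` P" unfolding M_def using fin F by (intro Max_in) auto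
  then obtain H where H: "H \<in> P" "s H = M" by auto
  have M: "0 < M" using s_le[OF F(1)] F(2) by simp
  define Y where "Y = (\<lambda>\<theta>. \<Sum>F\<in>P. growth \<alpha> \<theta> (s F) - 1)"
  define \<theta>0 where "\<theta>0 = \<alpha> * real (M - 1) + (1 - \<alpha>)"
  have gap: "1 - \<alpha> \<le> \<theta> - \<alpha> * real j" if "j < M" "\<theta>0 \<le> \<theta>" for j \<theta>
  proof -
    have "\<alpha> * real j \<le> \<alpha> * real (M - 1)" using that \<alpha> by (intro mult_left_mono) auto
    then show ?thesis using that by (simp add: \<theta>0_def)
  qed
  have valid: "\<alpha> * real j < \<theta>" if "j < M" "\<theta>0 \<le> \<theta>" for j \<theta>
    using gap[OF that] \<alpha> by linarith
  have start: "1 \<le> Y \<theta>0"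
  proof -
    obtain M' where M': "M = Suc M'" using M by (cases M) auto
    have "growth \<alpha> \<theta>0 M = growth \<alpha> \<theta>0 M' * 2" using \<alpha> by (simp add: growth_def M' \<theta>0_def)
    moreover have "1 \<le> growth \<alpha> \<theta>0 M'" using \<alpha> valid M' by (intro growth_ge_1) auto
    ultimately have "1 \<le> growth \<alpha> \<theta>0 (s H) - 1" using H by simp
    also have "\<dots> \<le> Y \<theta>0" unfolding Y_def using H fin \<alpha> valid s_le
      by (intro member_le_sum) (auto simp: less_le_trans intro!: growth_ge_1)
    finally show ?thesis .
  qed
  have "((\<lambda>\<theta>. 1 + (1 - \<alpha>) / (\<theta> - \<alpha> * real j)) \<longlongrightarrow> 1) at_top" for j
    by real_asymp
  then have "((\<lambda>\<theta>. growth \<alpha> \<theta> m) \<longlongrightarrow> (\<Prod>j<m. 1)) at_top" for m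
    unfolding growth_def by (intro tendsto_prod)
  then have "((\<lambda>\<theta>. growth \<alpha> \<theta> m) \<longlongrightarrow> 1) at_top" for m by simp
  then have "(Y \<longlongrightarrow> (\<Sum>F\<in>P. 1 - 1)) at_top" unfolding Y_def by (intro tendsto_intros)
  then have "\<forall>\<^sub>F \<theta> in at_top. Y \<theta> < 1" by (simp add: order_tendsto_iff)
  then have "\<forall>\<^sub>F \<theta> in at_top. Y \<theta> < 1 \<and> \<theta>0 \<le> \<theta>" using eventually_ge_at_top by (rule eventually_conj)
  then have "\<exists>\<theta>. Y \<theta> < 1 \<and> \<theta>0 \<le> \<theta>" by (intro eventually_happens') auto
  then obtain \<theta>1 where \<theta>1: "Y \<theta>1 \<le> 1" "\<theta>0 \<le> \<theta>1" by (auto intro: less_imp_le)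
  have "continuous_on {\<theta>0..\<theta>1} (\<lambda>\<theta>. growth \<alpha> \<theta> m)" if "m \<le> M" for m
    unfolding growth_def
  proof (intro continuous_intros ballI)
    fix j \<theta> assume "j \<in> {..<m}" "\<theta> \<in> {\<theta>0..\<theta>1}"
    then show "\<theta> - \<alpha> * real j \<noteq> 0" using valid[of j \<theta>] that by simp
  qed
  then have "continuous_on {\<theta>0..\<theta>1} Y" unfolding Y_def using s_le by (intro continuous_intros) auto
  then obtain \<theta> where "\<theta>0 \<le> \<theta>" "Y \<theta> = 1"
    using IVT2'[of Y \<theta>1 1 \<theta>0] \<theta>1 start by auto
  then show ?thesis by (intro that[of \<theta>] valid) (auto simp: Y_def M_def)
qed



section \<open>Spectral bounds for digraphs\<close>

lemma D_alpha_row_sum: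
  assumes "labelling G vs" and i: "i < length vs"
  shows "(\<Sum>j<length vs. D_alpha \<alpha> G vs $$ (i, j) * y (vs ! j)) =
    \<alpha> * real (transmission G (vs ! i)) * y (vs ! i)
      + (1 - \<alpha>) * (\<Sum>v\<in>verts G. real (distance G (vs ! i) v) * y v)"
proof -
  have "(\<Sum>j<length vs. D_alpha \<alpha> G vs $$ (i, j) * y (vs ! j)) =
      (\<Sum>j<length vs. (if i = j then \<alpha> * real (transmission G (vs ! i)) * y (vs ! i) else 0)
        + (1 - \<alpha>) * (real (distance G (vs ! i) (vs ! j)) * y (vs ! j)))"
    using i by (intro sum.cong) (auto simp: D_alpha_index algebra_simps)
  also have "\<dots> = \<alpha> * real (transmission G (vs ! i)) * y (vs ! i)
      + (1 - \<alpha>) * (\<Sum>j<length vs. real (distance G (vs ! i) (vs ! j)) * y (vs ! j))"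
    using i by (simp add: sum.distrib sum_distrib_left)
  also have "(\<Sum>j<length vs. real (distance G (vs ! i) (vs ! j)) * y (vs ! j)) =
      (\<Sum>v\<in>verts G. real (distance G (vs ! i) v) * y v)"
    using assms by (intro sum.reindex_bij_betw bij_betw_nth) (auto simp: labelling_def)
  finally show ?thesis .
qed

text \<open>The action of \<open>D\<^sub>\<alpha>(G)\<close> on functions of the vertices, free of any labelling.\<close>

definition D_alpha_apply :: "real \<Rightarrow> ('a, 'b) pre_digraph \<Rightarrow> ('a \<Rightarrow> real) \<Rightarrow> 'a \<Rightarrow> real" where
  "D_alpha_apply \<alpha> G y u = \<alpha> * real (transmission G u) * y u
     + (1 - \<alpha>) * (\<Sum>v\<in>verts G. real (distance G u v) * y v)"

lemma mu_alpha_bounds: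
  assumes "digraph G" and ne: "verts G \<noteq> {}" and \<alpha>: "0 \<le> \<alpha>" "\<alpha> < 1"
    and y: "\<And>u. u \<in> verts G \<Longrightarrow> 0 < y u"
  shows "(\<And>u. u \<in> verts G \<Longrightarrow> D_alpha_apply \<alpha> G y u \<le> \<mu> * y u) \<Longrightarrow> mu_alpha \<alpha> G \<le> \<mu>"
    and "(\<And>u. u \<in> verts G \<Longrightarrow> D_alpha_apply \<alpha> G y u < \<mu> * y u) \<Longrightarrow> mu_alpha \<alpha> G < \<mu>"
    and "(\<And>u. u \<in> verts G \<Longrightarrow> \<mu> * y u \<le> D_alpha_apply \<alpha> G y u) \<Longrightarrow> \<mu> \<le> mu_alpha \<alpha> G"
    and "\<lbrakk>\<And>u. u \<in> verts G \<Longrightarrow> \<mu> * y u \<le> D_alpha_apply \<alpha> G y u;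
          \<And>u v. u \<in> verts G \<Longrightarrow> v \<in> verts G \<Longrightarrow> u \<noteq> v \<Longrightarrow> 0 < distance G u v;
          w \<in> verts G; \<mu> * y w < D_alpha_apply \<alpha> G y w\<rbrakk> \<Longrightarrow> \<mu> < mu_alpha \<alpha> G"
proof -
  obtain vs where vs: "labelling G vs" using labelling_exists[OF assms(1)] by blast
  have mu: "mu_alpha \<alpha> G = spectral_radius (map_mat complex_of_real (D_alpha \<alpha> G vs))"
    by (rule mu_alpha_labelling[OF vs])
  have V: "vs ! i \<in> verts G" if "i < length vs" for i
    using vs nth_mem[OF that] by (simp add: labelling_def)
  have n: "0 < length vs" using vs ne by (auto simp: labelling_def)
  have row: "(\<Sum>j<length vs. D_alpha \<alpha> G vs $$ (i, j) * y (vs ! j)) = D_alpha_apply \<alpha> G y (vs ! i)"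
    if "i < length vs" for i using D_alpha_row_sum[OF vs that] by (simp add: D_alpha_apply_def)
  have nonneg: "0 \<le> D_alpha \<alpha> G vs $$ (i, j)" if "i < length vs" "j < length vs" for i j
    using that \<alpha> by (simp add: D_alpha_index)
  note hyps = D_alpha_dim(1) n nonneg y[OF V]
  show "mu_alpha \<alpha> G \<le> \<mu>" if "\<And>u. u \<in> verts G \<Longrightarrow> D_alpha_apply \<alpha> G y u \<le> \<mu> * y u"
    unfolding mu using that[OF V] row
    by (intro spectral_radius_le_of_subinvariant[where y = "\<lambda>i. y (vs ! i)", OF hyps]) auto
  show "mu_alpha \<alpha> G < \<mu>" if "\<And>u. u \<in> verts G \<Longrightarrow> D_alpha_apply \<alpha> G y u < \<mu> * y u"
    unfolding mu using that[OF V] row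
    by (intro spectral_radius_less_of_subinvariant[where y = "\<lambda>i. y (vs ! i)", OF hyps]) auto
  show "\<mu> \<le> mu_alpha \<alpha> G" if "\<And>u. u \<in> verts G \<Longrightarrow> \<mu> * y u \<le> D_alpha_apply \<alpha> G y u"
    unfolding mu using that[OF V] row
    by (intro spectral_radius_ge_of_superinvariant[where y = "\<lambda>i. y (vs ! i)", OF hyps]) auto
  show "\<mu> < mu_alpha \<alpha> G"
    if ge: "\<And>u. u \<in> verts G \<Longrightarrow> \<mu> * y u \<le> D_alpha_apply \<alpha> G y u"
      and d: "\<And>u v. u \<in> verts G \<Longrightarrow> v \<in> verts G \<Longrightarrow> u \<noteq> v \<Longrightarrow> 0 < distance G u v"
      and w: "w \<in> verts G" "\<mu> * y w < D_alpha_apply \<alpha> G y w"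
  proof -
    obtain m where m: "m < length vs" "vs ! m = w"
      using w(1) vs unfolding labelling_def by (metis in_set_conv_nth)
    have pos: "0 < D_alpha \<alpha> G vs $$ (i, j)" if "i < length vs" "j < length vs" "i \<noteq> j" for i j
      using that \<alpha> d[OF V V] vs by (simp add: D_alpha_index labelling_def nth_eq_iff_index_eq)
    show ?thesis unfolding mu
      using m w(2) row ge[OF V]
      by (intro spectral_radius_gt_of_superinvariant[where y = "\<lambda>i. y (vs ! i)" and m = m,
            OF hyps(1,3) pos hyps(4)]) auto
  qed
qed

section \<open>Ranked partitions\<close>

definition ranking :: "'a set set \<Rightarrow> ('a \<Rightarrow> nat) \<Rightarrow> bool" where
  "ranking P rk \<longleftrightarrow> (\<forall>F\<in>P. bij_betw rk F {..<card F})"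

text \<open>The pairs of distinct vertices \<open>u\<close>, \<open>v\<close> for which the join has no arc from \<open>u\<close> to \<open>v\<close>.\<close>

definition precedes :: "'a set set \<Rightarrow> ('a \<Rightarrow> nat) \<Rightarrow> 'a \<Rightarrow> 'a \<Rightarrow> bool" where
  "precedes P rk v u \<longleftrightarrow> (\<exists>F\<in>P. u \<in> F \<and> v \<in> F \<and> rk v < rk u)"

text \<open>The distance from \<open>u\<close> to \<open>v\<close> in the join of transitive tournaments on at least two ranked parts.\<close>

definition join_distance :: "'a set set \<Rightarrow> ('a \<Rightarrow> nat) \<Rightarrow> 'a \<Rightarrow> 'a \<Rightarrow> nat" where
  "join_distance P rk u v = of_bool (u \<noteq> v) + of_bool (precedes P rk v u)"

lemma not_precedes_refl [simp]: "\<not> precedes P rk u u"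
  by (simp add: precedes_def)

lemma sum_over_ranked_partition:
  fixes f :: "nat \<Rightarrow> real"
  assumes "finite V" "partition_on V P" "ranking P rk"
  shows "(\<Sum>v\<in>V. f (rk v)) = (\<Sum>F\<in>P. \<Sum>j<card F. f j)"
proof -
  have "(\<Sum>v\<in>V. f (rk v)) = (\<Sum>v\<in>\<Union>P. f (rk v))" using partition_onD1[OF assms(2)] by simp
  also have "\<dots> = (\<Sum>F\<in>P. \<Sum>v\<in>F. f (rk v))"
    using assms(1,2) by (intro sum.Union_disjoint[unfolded comp_def])
      (auto simp: partition_on_def disjoint_def intro: finite_subset)
  also have "\<dots> = (\<Sum>F\<in>P. \<Sum>j<card F. f j)"
    using assms(3) by (intro sum.cong sum.reindex_bij_betw) (auto simp: ranking_def)
  finally show ?thesis .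
qed

lemma sum_over_predecessors:
  fixes f :: "nat \<Rightarrow> real"
  assumes fin: "finite V" and P: "partition_on V P" and rk: "ranking P rk" and u: "u \<in> V"
  shows "(\<Sum>v\<in>V. of_bool (precedes P rk v u) * f (rk v)) = (\<Sum>j<rk u. f j)"
proof -
  obtain F where F: "F \<in> P" "u \<in> F" using partition_onD1[OF P] u by blast
  have bij: "bij_betw rk F {..<card F}" using rk F(1) by (simp add: ranking_def)
  have FV: "F \<subseteq> V" using partition_onD1[OF P] F(1) by blast
  have "precedes P rk v u \<longleftrightarrow> v \<in> F \<and> rk v < rk u" for v
    unfolding precedes_def using F P by (metis disjointD IntI empty_iff partition_onD2)
  then have "(\<Sum>v\<in>V. of_bool (precedes P rk v u) * f (rk v)) =
      (\<Sum>v\<in>V. if v \<in> {v \<in> F. rk v < rk u} then f (rk v) else 0)"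
    by (intro sum.cong) auto
  also have "\<dots> = (\<Sum>v\<in>{v \<in> F. rk v < rk u}. f (rk v))"
    using fin FV by (subst sum.inter_restrict[symmetric]) (auto intro!: sum.cong)
  also have "\<dots> = (\<Sum>j<rk u. f j)"
  proof (rule sum.reindex_bij_betw)
    have "rk ` {v \<in> F. rk v < rk u} = {..<rk u}"
    proof
      show "{..<rk u} \<subseteq> rk ` {v \<in> F. rk v < rk u}"
      proof
        fix j assume j: "j \<in> {..<rk u}"
        moreover have "rk u < card F" using bij_betwE[OF bij] F(2) by auto
        ultimately have "j \<in> rk ` F" using bij by (auto simp: bij_betw_def)
        then show "j \<in> rk ` {v \<in> F. rk v < rk u}" using j by auto
      qed
    qed auto
    then show "bij_betw rk {v \<in> F. rk v < rk u} {..<rk u}"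
      using bij by (auto simp: bij_betw_def inj_on_def)
  qed
  finally show ?thesis .
qed

text \<open>The left side is the row at \<open>u\<close> of \<open>D\<^sub>\<alpha>\<close> of the join, applied to the weights. Every other vertex contributes
its weight once, and a vertex that precedes \<open>u\<close> contributes it a second time; the latter weights sum to
\<open>growth \<alpha> \<theta> (rk u) - 1\<close>, and \<open>growth \<alpha> \<theta> (rk u)\<close> is a multiple of the weight at \<open>u\<close>. Up to a
multiple of the weight at \<open>u\<close>, the result is a constant.\<close>

lemma join_matrix_row:
  assumes fin: "finite V" and P: "partition_on V P" and rk: "ranking P rk" and u: "u \<in> V"
    and valid: "\<alpha> * real (rk u) < \<theta>"
  shows "\<alpha> * (\<Sum>v\<in>V. real (join_distance P rk u v)) * weight \<alpha> \<theta> (rk u)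
      + (1 - \<alpha>) * (\<Sum>v\<in>V. real (join_distance P rk u v) * weight \<alpha> \<theta> (rk v))
    = (\<theta> + \<alpha> * (real (card V) - 1) - (1 - \<alpha>)) * weight \<alpha> \<theta> (rk u)
      + (1 - \<alpha>) * ((\<Sum>F\<in>P. growth \<alpha> \<theta> (card F) - 1) - 1)"
proof -
  have row: "(\<Sum>v\<in>V. real (join_distance P rk u v) * f (rk v)) =
      (\<Sum>v\<in>V. f (rk v)) - f (rk u) + (\<Sum>j<rk u. f j)" for f :: "nat \<Rightarrow> real"
  proof -
    have "(\<Sum>v\<in>V. real (join_distance P rk u v) * f (rk v)) =
        (\<Sum>v\<in>V. f (rk v) - (if v = u then f (rk u) else 0) + of_bool (precedes P rk v u) * f (rk v))"
      by (intro sum.cong) (auto simp: join_distance_def)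
    also have "\<dots> = (\<Sum>v\<in>V. f (rk v)) - f (rk u) + (\<Sum>j<rk u. f j)"
      using fin u by (simp only: sum.distrib sum_subtractf sum_over_predecessors[OF fin P rk u] sum.delta) simp
    finally show ?thesis .
  qed
  have transmission: "(\<Sum>v\<in>V. real (join_distance P rk u v)) = real (card V) - 1 + real (rk u)"
    using row[of "\<lambda>_. 1"] by simp
  have weighted: "(\<Sum>v\<in>V. real (join_distance P rk u v) * weight \<alpha> \<theta> (rk v)) =
      (\<Sum>F\<in>P. growth \<alpha> \<theta> (card F) - 1) - weight \<alpha> \<theta> (rk u) + (growth \<alpha> \<theta> (rk u) - 1)"
    by (simp add: row sum_over_ranked_partition[OF fin P rk] sum_weight del: sum_subtractf)
  have "(\<theta> - \<alpha> * real (rk u)) * weight \<alpha> \<theta> (rk u) = (1 - \<alpha>) * growth \<alpha> \<theta> (rk u)"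
    using valid by (simp add: weight_eq)
  then show ?thesis unfolding transmission weighted by (simp add: algebra_simps)
qed



section \<open>Topological rankings\<close>

lemma acyclic_digraph_iff:
  assumes "wf_digraph G"
  shows "acyclic_digraph G \<longleftrightarrow> acyclic (arcs_ends G)"
proof -
  interpret wf_digraph G by fact
  have "(\<exists>p. cycle p) \<longleftrightarrow> (\<exists>u. u \<rightarrow>\<^sup>+\<^bsub>G\<^esub> u)"
    unfolding reachable1_awalk using closed_w_imp_cycle
    by (auto simp: closed_w_def cycle_def)
  then show ?thesis by (simp add: acyclic_digraph_def acyclic_def)
qed

lemma dominates_induce_subgraph_iff:
  "u \<rightarrow>\<^bsub>induce_subgraph G S\<^esub> v \<longleftrightarrow> u \<in> S \<and> v \<in> S \<and> u \<rightarrow>\<^bsub>G\<^esub> v"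
  by (auto simp: arcs_ends_conv)

text \<open>A sink exists because a finite acyclic relation is well-founded in reverse; it receives the highest rank.\<close>

lemma topological_ranking_exists:
  assumes "finite F" and "acyclic (R \<inter> F \<times> F)"
  shows "\<exists>rk. bij_betw rk F {..<card F} \<and> (\<forall>u\<in>F. \<forall>v\<in>F. (u, v) \<in> R \<longrightarrow> rk u < rk v)"
  using assms
proof (induction "card F" arbitrary: F)
  case 0
  then show ?case by (auto simp: bij_betw_def)
next
  case (Suc n)
  have wf: "wf ((R \<inter> F \<times> F)\<inverse>)"
    using Suc.prems by (intro finite_acyclic_wf_converse) auto
  have "F \<noteq> {}" using Suc.hyps(2) by auto
  have "\<exists>z\<in>F. \<forall>y\<in>F. (z, y) \<notin> R"
  proof (rule wfE_min'[OF wf \<open>F \<noteq> {}\<close>])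
    fix z assume z: "z \<in> F" and min: "\<And>y. (y, z) \<in> (R \<inter> F \<times> F)\<inverse> \<Longrightarrow> y \<notin> F"
    have "(z, y) \<notin> R" if "y \<in> F" for y using min[of y] z that by blast
    with z show ?thesis by (intro bexI[of _ z] ballI)
  qed
  then obtain z where z: "z \<in> F" and sink: "\<And>y. y \<in> F \<Longrightarrow> (z, y) \<notin> R" by (elim bexE) simp
  have card: "card (F - {z}) = n" using z Suc.hyps(2) Suc.prems(1) by simp
  have "acyclic (R \<inter> (F - {z}) \<times> (F - {z}))" by (rule acyclic_subset[OF Suc.prems(2)]) auto
  then obtain rk where bij: "bij_betw rk (F - {z}) {..<n}"
    and mono: "\<And>u v. u \<in> F - {z} \<Longrightarrow> v \<in> F - {z} \<Longrightarrow> (u, v) \<in> R \<Longrightarrow> rk u < rk v"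
    using Suc.hyps(1)[of "F - {z}"] Suc.prems(1) card by auto
  define rk' where "rk' = rk(z := n)"
  have "bij_betw rk' (F - {z}) {..<n}"
    using bij by (rule bij_betw_cong[THEN iffD1, rotated]) (simp add: rk'_def)
  then have "bij_betw rk' ((F - {z}) \<union> {z}) ({..<n} \<union> {rk' z})"
    by (subst notIn_Un_bij_betw3[symmetric]) (auto simp: rk'_def)
  moreover have "(F - {z}) \<union> {z} = F" using z by auto
  moreover have "{..<n} \<union> {rk' z} = {..<card F}" using Suc.hyps(2) by (auto simp: rk'_def)
  moreover have "rk' u < rk' v" if "u \<in> F" "v \<in> F" "(u, v) \<in> R" for u v
  proof -
    have "u \<noteq> z" using sink that by blast
    then show ?thesis using that mono[of u v] bij_betwE[OF bij] by (auto simp: rk'_def)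
  qed
  ultimately show ?case by (intro exI[of _ rk']) auto
qed

lemma (in digraph) out_degree_eq_card_dominated:
  "out_degree G u = card {v \<in> verts G. u \<rightarrow> v}"
proof -
  have "{v \<in> verts G. u \<rightarrow> v} = head G ` out_arcs G u"
    by (auto simp: arcs_ends_conv)
  moreover have "inj_on (head G) (out_arcs G u)"
    by (rule inj_onI) (auto simp: arc_to_ends_def intro: no_multi_arcs)
  ultimately show ?thesis by (simp add: out_degree_def card_image)
qed

text \<open>By induction on the score, a vertex beats exactly the vertices of smaller score: none of these beats it, by
the induction hypothesis, so it beats all of them, and since the scores are \<open>0, \<dots>, n - 1\<close> there are
as many of them as its own score allows. The rank counts the scores from the top.\<close>

lemma transitive_tournament_ranking:
  assumes "transitive_tournament H"
  shows "\<exists>rk. bij_betw rk (verts H) {..<card (verts H)} \<and>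
    (\<forall>u\<in>verts H. \<forall>v\<in>verts H. u \<rightarrow>\<^bsub>H\<^esub> v \<longleftrightarrow> rk u < rk v)"
proof -
  have tour: "tournament H" and scores: "out_degree H ` verts H = {0..<card (verts H)}"
    using assms by (auto simp: transitive_tournament_def)
  interpret digraph H using tour by (simp add: tournament_def)
  let ?n = "card (verts H)" and ?d = "out_degree H"
  have dichotomy: "(u \<rightarrow>\<^bsub>H\<^esub> v) \<noteq> (v \<rightarrow>\<^bsub>H\<^esub> u)" if "u \<in> verts H" "v \<in> verts H" "u \<noteq> v" for u v
    using tour that unfolding tournament_def by blast
  have inj: "inj_on ?d (verts H)" using scores by (intro eq_card_imp_inj_on) auto
  have d_less: "?d u < ?n" if "u \<in> verts H" for u
    using imageI[OF that, of ?d] unfolding scores by simp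
  have out: "?d u = card {v \<in> verts H. u \<rightarrow>\<^bsub>H\<^esub> v}" for u
    by (rule out_degree_eq_card_dominated)
  have beats: "u \<rightarrow>\<^bsub>H\<^esub> v \<longleftrightarrow> ?d v < ?d u" if "u \<in> verts H" "v \<in> verts H" for u v
    using that
  proof (induction "?d u" arbitrary: u v rule: less_induct)
    case less
    let ?lower = "{w \<in> verts H. ?d w < ?d u}"
    have "?lower \<subseteq> {w \<in> verts H. u \<rightarrow>\<^bsub>H\<^esub> w}"
    proof
      fix w assume w: "w \<in> ?lower"
      then have "\<not> w \<rightarrow>\<^bsub>H\<^esub> u" using less.hyps[of w u] less.prems(1) by simp
      moreover have "w \<noteq> u" using w by auto
      ultimately show "w \<in> {w \<in> verts H. u \<rightarrow>\<^bsub>H\<^esub> w}"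
        using w dichotomy[of u w] less.prems(1) by blast
    qed
    moreover have "card ?lower = ?d u"
    proof -
      have "?d u < ?n" using d_less[OF less.prems(1)] .
      have "?d ` ?lower = {0..<?d u}"
      proof
        show "{0..<?d u} \<subseteq> ?d ` ?lower"
        proof
          fix j assume j: "j \<in> {0..<?d u}"
          then have "j \<in> ?d ` verts H" using \<open>?d u < ?n\<close> unfolding scores by simp
          then show "j \<in> ?d ` ?lower" using j by auto
        qed
      qed auto
      moreover have "inj_on ?d ?lower" using inj by (rule inj_on_subset) auto
      ultimately show ?thesis using card_image by fastforce
    qed
    ultimately have "?lower = {w \<in> verts H. u \<rightarrow>\<^bsub>H\<^esub> w}"
      using out[of u] by (intro card_subset_eq) auto
    then show ?case using less.prems(2) by auto
  qed
  define rk where "rk u = ?n - Suc (?d u)" for u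
  have "inj_on rk (verts H)"
  proof (rule inj_onI)
    fix u v assume uv: "u \<in> verts H" "v \<in> verts H" "rk u = rk v"
    then have "?d u = ?d v" using d_less[of u] d_less[of v] by (simp add: rk_def)
    then show "u = v" using inj uv by (auto dest: inj_onD)
  qed
  moreover have "rk ` verts H \<subseteq> {..<?n}" by (auto simp: rk_def dest!: d_less)
  ultimately have "bij_betw rk (verts H) {..<?n}"
    by (simp add: bij_betw_def card_image card_subset_eq)
  moreover have "u \<rightarrow>\<^bsub>H\<^esub> v \<longleftrightarrow> rk u < rk v" if "u \<in> verts H" "v \<in> verts H" for u v
    using beats[OF that] d_less[OF that(1)] d_less[OF that(2)] by (auto simp: rk_def)
  ultimately show ?thesis by blast
qed

text \<open>Rankings chosen separately on disjoint parts combine to one function.\<close>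

lemma piecewise_ranking:
  assumes disj: "disjoint P"
    and ex: "\<And>F. F \<in> P \<Longrightarrow> \<exists>rk. bij_betw rk F {..<card F} \<and> (\<forall>u\<in>F. \<forall>v\<in>F. Q u v (rk u) (rk v))"
  shows "\<exists>rk :: 'a \<Rightarrow> nat. ranking P rk \<and> (\<forall>F\<in>P. \<forall>u\<in>F. \<forall>v\<in>F. Q u v (rk u) (rk v))"
proof -
  obtain r where r: "\<And>F. F \<in> P \<Longrightarrow> bij_betw (r F) F {..<card F}"
    "\<And>F u v. F \<in> P \<Longrightarrow> u \<in> F \<Longrightarrow> v \<in> F \<Longrightarrow> Q u v (r F u) (r F v)"
    using ex by metis
  define rk where "rk u = r (THE F. F \<in> P \<and> u \<in> F) u" for u
  have rk: "rk u = r F u" if "F \<in> P" "u \<in> F" for F u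
  proof -
    have "(THE F. F \<in> P \<and> u \<in> F) = F"
      using that disj by (intro the_equality) (auto dest: disjointD)
    then show ?thesis by (simp add: rk_def)
  qed
  have "bij_betw rk F {..<card F}" if "F \<in> P" for F
    using r(1)[OF that] rk[OF that] by (simp cong: bij_betw_cong)
  then have "ranking P rk" by (simp add: ranking_def)
  moreover have "Q u v (rk u) (rk v)" if "F \<in> P" "u \<in> F" "v \<in> F" for F u v
    using r(2)[OF that] rk that by simp
  ultimately show ?thesis by blast
qed

section \<open>Short distances\<close>

context digraph
begin

lemma distance_self: "u \<in> verts G \<Longrightarrow> distance G u u = 0"
  unfolding distance_def by (rule Least_equality) (auto simp: apath_Nil_iff intro!: exI[of _ "[]"])

lemma distance_ge:
  assumes "u \<rightarrow>\<^sup>* v" "u \<noteq> v"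
  shows "1 \<le> distance G u v" and "\<not> u \<rightarrow> v \<Longrightarrow> 2 \<le> distance G u v"
proof -
  obtain p where p: "apath u p v" "length p = distance G u v"
    unfolding distance_def using assms(1)
      LeastI_ex[of "\<lambda>l. \<exists>p. apath u p v \<and> length p = l"] by (auto simp: reachable_apath)
  then show "1 \<le> distance G u v" using assms(2) by (cases p) (auto simp: apath_Nil_iff)
  show "2 \<le> distance G u v" if "\<not> u \<rightarrow> v"
  proof (cases p)
    case Nil
    then show ?thesis using p(1) assms(2) by (simp add: apath_Nil_iff)
  next
    case (Cons e q)
    have "q \<noteq> []"
    proof
      assume "q = []"
      then have "e \<in> arcs G" "tail G e = u" "head G e = v"
        using p(1) Cons by (auto simp: apath_def awalk_Cons_iff awalk_Nil_iff)
      then show False using that by (auto simp: arcs_ends_conv)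
    qed
    then show ?thesis using p(2) Cons by (cases q) auto
  qed
qed

lemma distance_le_1:
  assumes "u \<rightarrow> v"
  shows "distance G u v \<le> 1"
proof -
  obtain e where e: "e \<in> arcs G" "tail G e = u" "head G e = v" using assms by auto
  then have "apath u [e] v" using no_loops by (auto simp: apath_def awalk_Cons_iff awalk_Nil_iff)
  then show ?thesis unfolding distance_def by (intro Least_le) auto
qed

lemma distance_le_2:
  assumes "u \<rightarrow> w" "w \<rightarrow> v" "u \<noteq> v"
  shows "distance G u v \<le> 2"
proof -
  obtain e f where e: "e \<in> arcs G" "tail G e = u" "head G e = w"
    and f: "f \<in> arcs G" "tail G f = w" "head G f = v" using assms by (metis reachableE)
  then have "apath u [e, f] v"
    using no_loops assms(3) by (auto simp: apath_def awalk_Cons_iff awalk_Nil_iff)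
  then show ?thesis unfolding distance_def by (intro Least_le) (auto intro!: exI[of _ "[e, f]"])
qed

lemma join_distance_le_distance:
  assumes sc: "strongly_connected G" and u: "u \<in> verts G" and v: "v \<in> verts G"
    and order: "precedes P rk v u \<Longrightarrow> \<not> u \<rightarrow> v"
  shows "join_distance P rk u v \<le> distance G u v"
  using distance_ge[of u v] sc u v order unfolding join_distance_def strongly_connected_def
  by (cases "u = v") auto

end

section \<open>Joins of transitive tournaments\<close>

lemma transitive_join_cross_arc:
  assumes "transitive_join_partition G P" "F \<in> P" "u \<in> F" "H \<in> P" "v \<in> H" "F \<noteq> H"
  shows "u \<rightarrow>\<^bsub>G\<^esub> v"
  using assms unfolding transitive_join_partition_def by blast

lemma transitive_join_ranking:
  assumes G: "digraph G" and join: "transitive_join_partition G P"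
  shows "\<exists>rk. ranking P rk \<and>
    (\<forall>u\<in>verts G. \<forall>v\<in>verts G. u \<rightarrow>\<^bsub>G\<^esub> v \<longleftrightarrow> u \<noteq> v \<and> \<not> precedes P rk v u)"
proof -
  have part: "partition_on (verts G) P" and disj: "disjoint P"
    using join by (auto simp: transitive_join_partition_def dest: partition_onD2)
  have "\<exists>rk. bij_betw rk F {..<card F} \<and> (\<forall>u\<in>F. \<forall>v\<in>F. u \<rightarrow>\<^bsub>G\<^esub> v \<longleftrightarrow> rk u < rk v)"
    if "F \<in> P" for F
    using transitive_tournament_ranking[of "induce_subgraph G F"] join that
    by (auto simp: transitive_join_partition_def dominates_induce_subgraph_iff)
  from piecewise_ranking[OF disj, of "\<lambda>u v i j. u \<rightarrow>\<^bsub>G\<^esub> v \<longleftrightarrow> i < j", OF this]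
  obtain rk where rk: "ranking P rk"
    and arc: "\<And>F u v. F \<in> P \<Longrightarrow> u \<in> F \<Longrightarrow> v \<in> F \<Longrightarrow> u \<rightarrow>\<^bsub>G\<^esub> v \<longleftrightarrow> rk u < rk v"
    by auto
  have "u \<rightarrow>\<^bsub>G\<^esub> v \<longleftrightarrow> u \<noteq> v \<and> \<not> precedes P rk v u" if u: "u \<in> verts G" and v: "v \<in> verts G" for u v
  proof -
    obtain F where F: "F \<in> P" "u \<in> F" using u part by (metis UnionE partition_onD1)
    obtain H where H: "H \<in> P" "v \<in> H" using v part by (metis UnionE partition_onD1)
    show ?thesis
    proof (cases "F = H")
      case True
      have "precedes P rk v u \<longleftrightarrow> rk v < rk u"
        using F H True disj unfolding precedes_def by blast
      moreover have "rk u = rk v \<longleftrightarrow> u = v"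
        using rk F H True by (auto simp: ranking_def bij_betw_def inj_on_def)
      ultimately show ?thesis using arc[OF F(1,2)] H(2) True by auto
    next
      case False
      then have "\<not> precedes P rk v u" "u \<noteq> v"
        using F H disj by (auto simp: precedes_def dest: disjointD)
      moreover have "u \<rightarrow>\<^bsub>G\<^esub> v" by (rule transitive_join_cross_arc[OF join F H False])
      ultimately show ?thesis by simp
    qed
  qed
  with rk show ?thesis by blast
qed

text \<open>A missing arc joins two vertices of the same part, and every vertex of another part is adjacent to both of them in
both directions.\<close>

lemma transitive_join_detour:
  assumes join: "transitive_join_partition G P" and two: "2 \<le> card P"
    and u: "u \<in> verts G" and v: "v \<in> verts G" and no_arc: "\<not> u \<rightarrow>\<^bsub>G\<^esub> v"
  shows "\<exists>w. u \<rightarrow>\<^bsub>G\<^esub> w \<and> w \<rightarrow>\<^bsub>G\<^esub> v"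
proof -
  have part: "partition_on (verts G) P" using join by (simp add: transitive_join_partition_def)
  obtain F where F: "F \<in> P" "u \<in> F" using u part by (metis UnionE partition_onD1)
  obtain H where H: "H \<in> P" "v \<in> H" using v part by (metis UnionE partition_onD1)
  have "F = H" using no_arc transitive_join_cross_arc[OF join F H] by blast
  have "\<not> P \<subseteq> {F}" using two card_mono[of "{F}" P] by auto
  then obtain W where W: "W \<in> P" "W \<noteq> F" by auto
  then obtain w where "w \<in> W" using partition_onD3[OF part] by (metis ex_in_conv)
  then show ?thesis
    using W F H \<open>F = H\<close> transitive_join_cross_arc[OF join] by metis
qed

lemma transitive_join_strongly_connected:
  assumes G: "digraph G" and join: "transitive_join_partition G P" and two: "2 \<le> card P"
  shows "strongly_connected G"
proof -
  interpret digraph G by fact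
  have "P \<noteq> {}" using two by auto
  moreover have part: "partition_on (verts G) P" using join by (simp add: transitive_join_partition_def)
  ultimately have "verts G \<noteq> {}" by (metis partition_onD1 partition_onD3 Sup_bot_conv(1) all_not_in_conv)
  moreover have "u \<rightarrow>\<^sup>*\<^bsub>G\<^esub> v" if "u \<in> verts G" "v \<in> verts G" for u v
    using transitive_join_detour[OF join two that]
    by (meson adj_reachable_trans reachable_adjI)
  ultimately show ?thesis by (simp add: strongly_connected_def)
qed

lemma transitive_join_distance:
  assumes G: "digraph G" and join: "transitive_join_partition G P" and two: "2 \<le> card P"
    and arcs: "\<And>u v. u \<in> verts G \<Longrightarrow> v \<in> verts G \<Longrightarrow> u \<rightarrow>\<^bsub>G\<^esub> v \<longleftrightarrow> u \<noteq> v \<and> \<not> precedes P rk v u"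
    and u: "u \<in> verts G" and v: "v \<in> verts G"
  shows "distance G u v = join_distance P rk u v"
proof -
  interpret digraph G by fact
  have "distance G u v \<le> join_distance P rk u v"
  proof (cases "u = v")
    case True
    then show ?thesis using distance_self[OF u] by simp
  next
    case False
    show ?thesis
    proof (cases "u \<rightarrow>\<^bsub>G\<^esub> v")
      case True
      then show ?thesis using distance_le_1[OF True] False by (simp add: join_distance_def)
    next
      case no_arc: False
      then have "precedes P rk v u" using arcs[OF u v] False by simp
      moreover have "distance G u v \<le> 2"
        using transitive_join_detour[OF join two u v no_arc] distance_le_2 False by blast
      ultimately show ?thesis using False by (simp add: join_distance_def)
    qed
  qed
  moreover have "join_distance P rk u v \<le> distance G u v"
    using transitive_join_strongly_connected[OF G join two] u v arcs[OF u v]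
    by (intro join_distance_le_distance) auto
  ultimately show ?thesis by simp
qed



section \<open>Dichromatic number\<close>

lemma acyclic_set_iff:
  assumes "digraph G"
  shows "acyclic_set G F \<longleftrightarrow> F \<subseteq> verts G \<and> acyclic (arcs_ends G \<inter> F \<times> F)"
proof -
  interpret digraph G by fact
  have "arcs_ends (induce_subgraph G F) = arcs_ends G \<inter> F \<times> F"
    using dominates_induce_subgraph_iff[where G = G and S = F] by auto
  then show ?thesis
    using acyclic_digraph_iff[OF wellformed_induce_subgraph] by (simp add: acyclic_set_def)
qed

text \<open>The parts are acyclic because ranks increase along their arcs. Conversely, two vertices from
different parts form a directed cycle of length 2, so an acyclic set lies within one part. In a partition into
acyclic sets, choosing for each part a set that meets it is therefore injective.\<close>

lemma transitive_join_dichromatic_number: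
  assumes G: "digraph G" and join: "transitive_join_partition G P"
  shows "dichromatic_number G = card P"
  unfolding dichromatic_number_def
proof (rule Least_equality)
  interpret digraph G by fact
  have part: "partition_on (verts G) P" using join by (simp add: transitive_join_partition_def)
  obtain rk where rk: "ranking P rk"
    and arcs: "\<And>u v. u \<in> verts G \<Longrightarrow> v \<in> verts G \<Longrightarrow> u \<rightarrow>\<^bsub>G\<^esub> v \<longleftrightarrow> u \<noteq> v \<and> \<not> precedes P rk v u"
    using transitive_join_ranking[OF G join] by blast
  have "acyclic_set G F" if F: "F \<in> P" for F
  proof -
    have FV: "F \<subseteq> verts G" using part F by (auto dest: partition_onD1)
    have inj: "inj_on rk F" using rk F by (simp add: ranking_def bij_betw_def)
    have "acyclic (arcs_ends G \<inter> F \<times> F)"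
    proof (rule acyclicI_order[where f = "\<lambda>u. - int (rk u)"])
      fix u v assume uv: "(u, v) \<in> arcs_ends G \<inter> F \<times> F"
      then have "u \<noteq> v" "\<not> rk v < rk u" using arcs[of u v] F FV by (auto simp: precedes_def)
      moreover have "rk u \<noteq> rk v" using inj uv \<open>u \<noteq> v\<close> by (auto dest: inj_onD)
      ultimately show "- int (rk v) < - int (rk u)" by simp
    qed
    then show ?thesis using FV by (simp add: acyclic_set_iff[OF G])
  qed
  then show "\<exists>P'. partition_on (verts G) P' \<and> card P' = card P \<and> (\<forall>F\<in>P'. acyclic_set G F)"
    using part by blast
next
  interpret digraph G by fact
  have part: "partition_on (verts G) P" using join by (simp add: transitive_join_partition_def)
  fix k assume "\<exists>Q. partition_on (verts G) Q \<and> card Q = k \<and> (\<forall>S\<in>Q. acyclic_set G S)"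
  then obtain Q where Q: "partition_on (verts G) Q" "card Q = k"
    and acyc: "\<And>S. S \<in> Q \<Longrightarrow> acyclic_set G S" by blast
  have same: "F = H" if S: "S \<in> Q" and F: "F \<in> P" "u \<in> F" "u \<in> S" and H: "H \<in> P" "v \<in> H" "v \<in> S"
    for S F H u v
  proof (rule ccontr)
    assume "F \<noteq> H"
    then have "u \<rightarrow>\<^bsub>G\<^esub> v" "v \<rightarrow>\<^bsub>G\<^esub> u"
      using transitive_join_cross_arc[OF join] F H by blast+
    then have "(u, v) \<in> arcs_ends G \<inter> S \<times> S" "(v, u) \<in> arcs_ends G \<inter> S \<times> S"
      using F(3) H(3) by simp_all
    then have "(u, u) \<in> (arcs_ends G \<inter> S \<times> S)\<^sup>+"
      by (rule trancl_into_trancl[OF r_into_trancl])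
    then show False using acyc[OF S] unfolding acyclic_set_iff[OF G] acyclic_def by blast
  qed
  have "\<exists>S\<in>Q. S \<inter> F \<noteq> {}" if F: "F \<in> P" for F
  proof -
    obtain u where u: "u \<in> F" using partition_onD3[OF part] F by (metis ex_in_conv)
    then have "u \<in> verts G" using part F by (auto dest: partition_onD1)
    then obtain S where "S \<in> Q" "u \<in> S" using Q(1) by (metis UnionE partition_onD1)
    then show ?thesis using u by blast
  qed
  then obtain c where c: "\<And>F. F \<in> P \<Longrightarrow> c F \<in> Q \<and> c F \<inter> F \<noteq> {}" by metis
  have "inj_on c P"
  proof (rule inj_onI)
    fix F H assume FH: "F \<in> P" "H \<in> P" "c F = c H"
    then obtain u v where "u \<in> c F" "u \<in> F" "v \<in> c F" "v \<in> H" using c by (metis disjoint_iff)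
    then show "F = H" using same[of "c F" F u H v] FH c by blast
  qed
  moreover have "c ` P \<subseteq> Q" using c by blast
  ultimately show "card P \<le> k"
    using card_inj_on_le[of c P Q] finite_elements[OF finite_verts Q(1)] Q(2) by simp
qed

text \<open>Singletons are acyclic, so some partition into acyclic sets exists and the minimum is taken over a nonempty set.\<close>

lemma dichromatic_number_attained:
  assumes G: "digraph G"
  obtains P where "partition_on (verts G) P" "card P = dichromatic_number G"
    "\<And>F. F \<in> P \<Longrightarrow> acyclic_set G F"
proof -
  interpret digraph G by fact
  let ?S = "(\<lambda>v. {v}) ` verts G"
  have "partition_on (verts G) ?S" by (rule partition_onI) auto
  moreover have "acyclic_set G F" if "F \<in> ?S" for F
  proof -
    have "arcs_ends G \<inter> F \<times> F = {}" using that adj_not_same by auto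
    then show ?thesis using that by (auto simp: acyclic_set_iff[OF G] acyclic_def)
  qed
  ultimately have "\<exists>k P. partition_on (verts G) P \<and> card P = k \<and> (\<forall>F\<in>P. acyclic_set G F)" by blast
  from LeastI_ex[OF this] show ?thesis using that unfolding dichromatic_number_def by blast
qed

lemma acyclic_partition_ranking:
  assumes G: "digraph G" and part: "partition_on (verts G) P"
    and acyc: "\<And>F. F \<in> P \<Longrightarrow> acyclic_set G F"
  shows "\<exists>rk. ranking P rk \<and> (\<forall>u v. precedes P rk v u \<longrightarrow> \<not> u \<rightarrow>\<^bsub>G\<^esub> v)"
proof -
  interpret digraph G by fact
  have "\<exists>rk. bij_betw rk F {..<card F} \<and> (\<forall>u\<in>F. \<forall>v\<in>F. u \<rightarrow>\<^bsub>G\<^esub> v \<longrightarrow> rk u < rk v)" if "F \<in> P" for F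
    using acyc[OF that] finite_verts
    by (intro topological_ranking_exists) (auto simp: acyclic_set_iff[OF G] intro: finite_subset)
  from piecewise_ranking[OF partition_onD2[OF part], of "\<lambda>u v i j. u \<rightarrow>\<^bsub>G\<^esub> v \<longrightarrow> i < j", OF this]
  show ?thesis unfolding precedes_def by (metis less_asym)
qed

section \<open>Comparison with the balanced join\<close>

lemma sum_card_partition:
  assumes "finite V" "partition_on V P" "ranking P rk"
  shows "sum card P = card V"
proof -
  have "real (card V) = real (sum card P)"
    using sum_over_ranked_partition[OF assms, of "\<lambda>_. 1"] by simp
  then show ?thesis by (simp only: of_nat_eq_iff)
qed

text \<open>A single pair \<open>\<theta>\<close>, \<open>\<mu>\<close>, determined by the part sizes of \<open>G\<close>, bounds both spectral radii. The spectral
radius of \<open>T\<close> itself is never computed: the weights for this \<open>\<theta>\<close> form a subinvariant vector on \<open>T\<close>.\<close>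

lemma mu_alpha_balanced_join_le:
  fixes G :: "('c, 'd) pre_digraph" and T :: "('a, 'b) pre_digraph"
  assumes \<alpha>: "0 \<le> \<alpha>" "\<alpha> < 1"
    and G: "digraph G" and sc: "strongly_connected G" and P: "partition_on (verts G) P"
    and rk: "ranking P rk" and order: "\<forall>u v. precedes P rk v u \<longrightarrow> \<not> u \<rightarrow>\<^bsub>G\<^esub> v"
    and T: "digraph T" and join: "transitive_join_partition T Q"
    and balanced: "\<forall>V\<in>Q. \<forall>W\<in>Q. card V \<le> Suc (card W)"
    and two: "2 \<le> card Q" and parts: "card P = card Q" and size: "card (verts G) = card (verts T)"
  shows "mu_alpha \<alpha> T \<le> mu_alpha \<alpha> G"
    and "mu_alpha \<alpha> G = mu_alpha \<alpha> T \<Longrightarrow>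
      (\<exists>q. (\<forall>F\<in>P. card F \<in> {q, Suc q}) \<and> (\<forall>F\<in>Q. card F \<in> {q, Suc q})) \<and>
      (\<forall>u\<in>verts G. \<forall>v\<in>verts G. distance G u v = join_distance P rk u v)"
proof -
  interpret G: digraph G by fact
  interpret T: digraph T by fact
  have Q: "partition_on (verts T) Q" using join by (simp add: transitive_join_partition_def)
  obtain rk' where rk': "ranking Q rk'" and arcs_T: "\<And>u v. u \<in> verts T \<Longrightarrow> v \<in> verts T \<Longrightarrow>
      u \<rightarrow>\<^bsub>T\<^esub> v \<longleftrightarrow> u \<noteq> v \<and> \<not> precedes Q rk' v u"
    using transitive_join_ranking[OF T join] by blast
  have finP: "finite P" and finQ: "finite Q"
    using finite_elements P Q G.finite_verts T.finite_verts by blast+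
  have "P \<noteq> {}" "Q \<noteq> {}" using two parts by auto
  then obtain F0 where F0: "F0 \<in> P" by blast
  have "F0 \<noteq> {}" "finite F0"
    using F0 P by (auto simp: partition_on_def intro: finite_subset[OF _ G.finite_verts])
  then have "0 < card F0" by (simp add: card_gt_0_iff)
  define M where "M = Max (card ` P)"
  obtain \<theta> where valid: "\<And>j. j < M \<Longrightarrow> \<alpha> * real j < \<theta>"
    and root: "(\<Sum>F\<in>P. growth \<alpha> \<theta> (card F) - 1) = 1"
    using growth_root_exists[where s = card and P = P, OF \<alpha> finP F0 \<open>0 < card F0\<close>] unfolding M_def by blast
  define \<mu> where "\<mu> = \<theta> + \<alpha> * (real (card (verts G)) - 1) - (1 - \<alpha>)"
  have P_le: "card F \<le> M" if "F \<in> P" for F using that finP by (simp add: M_def)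
  have total: "sum card P = sum card Q"
    using sum_card_partition P Q rk rk' size by (metis G.finite_verts T.finite_verts)
  have convex: "growth \<alpha> \<theta> (Suc m) - growth \<alpha> \<theta> m < growth \<alpha> \<theta> (Suc (Suc m)) - growth \<alpha> \<theta> (Suc m)"
    if "Suc (Suc m) \<le> M" for m
    using that by (intro growth_strictly_convex \<alpha> valid) simp
  note compare = balanced_sizes_minimise_convex_sum[where s = card and t = card and M = M
        and g = "growth \<alpha> \<theta>", OF finP finQ parts \<open>Q \<noteq> {}\<close> total]
  have Q_le: "card F \<le> M" if "F \<in> Q" for F
    by (rule compare(1)) (use balanced P_le convex that in auto)
  have sum_le: "(\<Sum>F\<in>Q. growth \<alpha> \<theta> (card F)) \<le> (\<Sum>F\<in>P. growth \<alpha> \<theta> (card F))"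
    by (rule compare(2)) (use balanced P_le convex in auto)
  have sum_eq: "\<exists>q. (\<forall>F\<in>P. card F \<in> {q, Suc q}) \<and> (\<forall>F\<in>Q. card F \<in> {q, Suc q})"
    if "(\<Sum>F\<in>Q. growth \<alpha> \<theta> (card F)) = (\<Sum>F\<in>P. growth \<alpha> \<theta> (card F))"
    by (rule compare(3)) (use balanced P_le convex that in auto)
  have rank_less: "rk u < M" if "u \<in> verts G" for u
  proof -
    obtain F where "F \<in> P" "u \<in> F" using \<open>u \<in> verts G\<close> P by (metis UnionE partition_onD1)
    then have "rk u < card F" using rk by (auto simp: ranking_def dest: bij_betwE)
    then show ?thesis using P_le[OF \<open>F \<in> P\<close>] by simp
  qed
  have rank_less': "rk' u < M" if "u \<in> verts T" for u
  proof -
    obtain F where "F \<in> Q" "u \<in> F" using \<open>u \<in> verts T\<close> Q by (metis UnionE partition_onD1)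
    then have "rk' u < card F" using rk' by (auto simp: ranking_def dest: bij_betwE)
    then show ?thesis using Q_le[OF \<open>F \<in> Q\<close>] by simp
  qed
  let ?y = "\<lambda>u. weight \<alpha> \<theta> (rk u)" and ?y' = "\<lambda>u. weight \<alpha> \<theta> (rk' u)"
  have y: "0 < ?y u" if "u \<in> verts G" for u
    using rank_less[OF that] by (intro weight_pos \<alpha> valid) simp
  have y': "0 < ?y' u" if "u \<in> verts T" for u
    using rank_less'[OF that] by (intro weight_pos \<alpha> valid) simp
  have ne: "verts G \<noteq> {}" "verts T \<noteq> {}"
    using sc size by (auto simp: strongly_connected_def)
  have sums: "(\<Sum>F\<in>Q. growth \<alpha> \<theta> (card F) - 1) = 1 + ((\<Sum>F\<in>Q. growth \<alpha> \<theta> (card F)) - (\<Sum>F\<in>P. growth \<alpha> \<theta> (card F)))"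
    using root parts by (simp add: sum_subtractf)
  \<comment> \<open>The amount by which the balanced sizes decrease the sum of the values of \<open>growth\<close>.\<close>
  define \<delta> where "\<delta> = (\<Sum>F\<in>P. growth \<alpha> \<theta> (card F)) - (\<Sum>F\<in>Q. growth \<alpha> \<theta> (card F))"
  have \<delta>: "0 \<le> \<delta>" using sum_le by (simp add: \<delta>_def)
  have row_T: "D_alpha_apply \<alpha> T ?y' u = \<mu> * ?y' u - (1 - \<alpha>) * \<delta>" if u: "u \<in> verts T" for u
  proof -
    have dist: "distance T u v = join_distance Q rk' u v" if "v \<in> verts T" for v
      by (rule transitive_join_distance[OF T join two arcs_T u that])
    have "D_alpha_apply \<alpha> T ?y' u =
        \<alpha> * (\<Sum>v\<in>verts T. real (join_distance Q rk' u v)) * ?y' u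
        + (1 - \<alpha>) * (\<Sum>v\<in>verts T. real (join_distance Q rk' u v) * ?y' v)"
      by (simp add: D_alpha_apply_def transmission_def dist)
    also have "\<dots> = \<mu> * ?y' u + (1 - \<alpha>) * ((\<Sum>F\<in>Q. growth \<alpha> \<theta> (card F) - 1) - 1)"
      using join_matrix_row[OF T.finite_verts Q rk' u valid[OF rank_less'[OF u]]] by (simp add: \<mu>_def size)
    finally show ?thesis unfolding sums by (simp add: \<delta>_def algebra_simps)
  qed
  have dist_ge: "join_distance P rk u v \<le> distance G u v" if "u \<in> verts G" "v \<in> verts G" for u v
    using order by (intro G.join_distance_le_distance sc that) auto
  have row_G: "D_alpha_apply \<alpha> G ?y u = \<mu> * ?y u
      + (\<alpha> * (\<Sum>v\<in>verts G. real (distance G u v) - real (join_distance P rk u v)) * ?y u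
      + (1 - \<alpha>) * (\<Sum>v\<in>verts G. (real (distance G u v) - real (join_distance P rk u v)) * ?y v))"
    if u: "u \<in> verts G" for u
  proof -
    have "\<alpha> * (\<Sum>v\<in>verts G. real (join_distance P rk u v)) * ?y u
        + (1 - \<alpha>) * (\<Sum>v\<in>verts G. real (join_distance P rk u v) * ?y v) = \<mu> * ?y u"
      using join_matrix_row[OF G.finite_verts P rk u valid[OF rank_less[OF u]]] by (simp add: \<mu>_def root)
    then show ?thesis
      by (simp add: D_alpha_apply_def transmission_def sum_subtractf left_diff_distrib right_diff_distrib)
  qed
  have excess: "0 \<le> \<alpha> * (\<Sum>v\<in>verts G. real (distance G u v) - real (join_distance P rk u v)) * ?y u"
    "0 \<le> (\<Sum>v\<in>verts G. (real (distance G u v) - real (join_distance P rk u v)) * ?y v)"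
    if u: "u \<in> verts G" for u
    using dist_ge[OF u] y u \<alpha> by (auto intro!: mult_nonneg_nonneg sum_nonneg simp: less_imp_le)
  have G_ge: "\<mu> * ?y u \<le> D_alpha_apply \<alpha> G ?y u" if u: "u \<in> verts G" for u
    using excess[OF u] \<alpha> by (simp add: row_G[OF u])
  have low: "\<mu> \<le> mu_alpha \<alpha> G" using mu_alpha_bounds(3)[OF G ne(1) \<alpha>, of ?y \<mu>] y G_ge by simp
  have up: "mu_alpha \<alpha> T \<le> \<mu>"
    using mu_alpha_bounds(1)[OF T ne(2) \<alpha>, of ?y' \<mu>] y' row_T \<delta> \<alpha> by simp
  show "mu_alpha \<alpha> T \<le> mu_alpha \<alpha> G" using low up by simp

  assume eq: "mu_alpha \<alpha> G = mu_alpha \<alpha> T"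
  have "\<delta> = 0"
  proof (rule ccontr)
    assume "\<delta> \<noteq> 0"
    then have "mu_alpha \<alpha> T < \<mu>"
      using mu_alpha_bounds(2)[OF T ne(2) \<alpha>, of ?y' \<mu>] y' row_T \<delta> \<alpha> by simp
    then show False using eq low by simp
  qed
  then have "\<exists>q. (\<forall>F\<in>P. card F \<in> {q, Suc q}) \<and> (\<forall>F\<in>Q. card F \<in> {q, Suc q})"
    using sum_eq by (simp add: \<delta>_def)
  moreover have "distance G u v = join_distance P rk u v" if u: "u \<in> verts G" and v: "v \<in> verts G" for u v
  proof (rule ccontr)
    assume "distance G u v \<noteq> join_distance P rk u v"
    then have "0 < (real (distance G u v) - real (join_distance P rk u v)) * ?y v"
      using dist_ge[OF u v] y[OF v] by simp
    also have "\<dots> \<le> (\<Sum>v\<in>verts G. (real (distance G u v) - real (join_distance P rk u v)) * ?y v)"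
      using dist_ge[OF u] y v by (intro member_le_sum) (auto simp: less_imp_le)
    finally have "\<mu> * ?y u < D_alpha_apply \<alpha> G ?y u"
      using excess(1)[OF u] \<alpha> by (simp add: row_G[OF u] add_nonneg_pos)
    moreover have "0 < distance G a b" if "a \<in> verts G" "b \<in> verts G" "a \<noteq> b" for a b
      using G.distance_ge(1)[of a b] sc that by (auto simp: strongly_connected_def)
    ultimately have "\<mu> < mu_alpha \<alpha> G"
      using mu_alpha_bounds(4)[OF G ne(1) \<alpha>, of ?y \<mu> u] y G_ge u by blast
    then show False using eq up by simp
  qed
  ultimately show "(\<exists>q. (\<forall>F\<in>P. card F \<in> {q, Suc q}) \<and> (\<forall>F\<in>Q. card F \<in> {q, Suc q})) \<and>
      (\<forall>u\<in>verts G. \<forall>v\<in>verts G. distance G u v = join_distance P rk u v)" by blast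
qed



section \<open>Isomorphism of joins with equal part sizes\<close>

text \<open>Without parallel arcs, arcs correspond to the pairs of their ends, so the map of the arcs is determined by the map
of the vertices.\<close>

lemma digraph_iso_of_arc_preserving:
  fixes G :: "('c, 'd) pre_digraph" and H :: "('a, 'b) pre_digraph"
  assumes G: "digraph G" and H: "digraph H" and \<phi>: "bij_betw \<phi> (verts G) (verts H)"
    and arcs: "\<And>u v. u \<in> verts G \<Longrightarrow> v \<in> verts G \<Longrightarrow> u \<rightarrow>\<^bsub>G\<^esub> v \<longleftrightarrow> \<phi> u \<rightarrow>\<^bsub>H\<^esub> \<phi> v"
  shows "digraph_iso G H"
proof -
  interpret G: digraph G by fact
  interpret H: digraph H by fact
  have inj: "inj_on \<phi> (verts G)" and img: "\<phi> ` verts G = verts H"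
    using \<phi> by (auto simp: bij_betw_def)
  have "\<exists>b. b \<in> arcs H \<and> tail H b = \<phi> (tail G a) \<and> head H b = \<phi> (head G a)" if "a \<in> arcs G" for a
  proof -
    have "tail G a \<rightarrow>\<^bsub>G\<^esub> head G a" using that by (auto simp: arcs_ends_conv)
    then have "\<phi> (tail G a) \<rightarrow>\<^bsub>H\<^esub> \<phi> (head G a)" using arcs that by simp
    then show ?thesis by (auto simp: arcs_ends_conv)
  qed
  then obtain \<psi> where \<psi>: "\<And>a. a \<in> arcs G \<Longrightarrow> \<psi> a \<in> arcs H"
    "\<And>a. a \<in> arcs G \<Longrightarrow> tail H (\<psi> a) = \<phi> (tail G a)"
    "\<And>a. a \<in> arcs G \<Longrightarrow> head H (\<psi> a) = \<phi> (head G a)" by metis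
  have "inj_on \<psi> (arcs G)"
  proof (rule inj_onI)
    fix a b assume ab: "a \<in> arcs G" "b \<in> arcs G" "\<psi> a = \<psi> b"
    then have "tail G a = tail G b" "head G a = head G b"
      using \<psi>(2,3)[of a] \<psi>(2,3)[of b] inj_on_eq_iff[OF inj] by simp_all
    then show "a = b" using ab by (intro G.no_multi_arcs) (auto simp: arc_to_ends_def)
  qed
  moreover have "\<psi> ` arcs G = arcs H"
  proof
    show "arcs H \<subseteq> \<psi> ` arcs G"
    proof
      fix b assume b: "b \<in> arcs H"
      then obtain u v where uv: "u \<in> verts G" "v \<in> verts G" "tail H b = \<phi> u" "head H b = \<phi> v"
        using img by (metis H.head_in_verts H.tail_in_verts imageE)
      have "tail H b \<rightarrow>\<^bsub>H\<^esub> head H b" using b by (auto simp: arcs_ends_conv)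
      then have "u \<rightarrow>\<^bsub>G\<^esub> v" using arcs uv by simp
      then obtain a where a: "a \<in> arcs G" "tail G a = u" "head G a = v" by auto
      then have "\<psi> a = b" using b \<psi> uv by (intro H.no_multi_arcs) (auto simp: arc_to_ends_def)
      then show "b \<in> \<psi> ` arcs G" using a by blast
    qed
  qed (use \<psi> in auto)
  moreover define f where "f = \<lparr>iso_verts = \<phi>, iso_arcs = \<psi>, iso_head = head H, iso_tail = tail H\<rparr>"
  ultimately have "pre_digraph.digraph_isomorphism G f" "H = app_iso f G"
    using inj img \<psi> G.wf_digraph
    by (auto simp: pre_digraph.digraph_isomorphism_def app_iso_def)
  then show ?thesis by (auto simp: digraph_iso_def)
qed

lemma precedes_iff:
  assumes "disjoint P" "F \<in> P" "u \<in> F" "H \<in> P" "v \<in> H"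
  shows "precedes P rk v u \<longleftrightarrow> F = H \<and> rk v < rk u"
  using assms unfolding precedes_def by (metis disjointD disjoint_iff)

text \<open>Each vertex goes to the vertex of the same rank in the corresponding part.\<close>

lemma ranked_partition_isomorphism:
  fixes P :: "'c set set" and Q :: "'a set set"
  assumes P: "partition_on V P" "ranking P rk" and Q: "partition_on W Q" "ranking Q rk'"
    and \<beta>: "bij_betw \<beta> P Q" and size: "\<And>F. F \<in> P \<Longrightarrow> card (\<beta> F) = card F"
  obtains \<phi> where "bij_betw \<phi> V W"
    and "\<And>u v. u \<in> V \<Longrightarrow> v \<in> V \<Longrightarrow> precedes P rk v u \<longleftrightarrow> precedes Q rk' (\<phi> v) (\<phi> u)"
proof -
  define part where "part u = (THE F. F \<in> P \<and> u \<in> F)" for u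
  have part: "part u = F" if "F \<in> P" "u \<in> F" for F u
    unfolding part_def using that partition_onD2[OF P(1)]
    by (intro the_equality) (auto dest: disjointD)
  define \<phi> where "\<phi> u = inv_into (\<beta> (part u)) rk' (rk u)" for u
  have rk: "bij_betw rk F {..<card F}" if "F \<in> P" for F
    using P(2) that by (simp add: ranking_def)
  have \<beta>Q: "\<beta> F \<in> Q" if "F \<in> P" for F using \<beta> that by (auto dest: bij_betwE)
  have rk': "bij_betw rk' (\<beta> F) {..<card F}" if "F \<in> P" for F
    using Q(2) \<beta>Q[OF that] size[OF that] by (auto simp: ranking_def)
  have \<phi>: "\<phi> u \<in> \<beta> F" "rk' (\<phi> u) = rk u" if "F \<in> P" "u \<in> F" for F u
  proof -
    have "rk u \<in> rk' ` \<beta> F"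
      using bij_betwE[OF rk[OF that(1)]] rk'[OF that(1)] that(2) by (auto simp: bij_betw_def)
    then show "\<phi> u \<in> \<beta> F" "rk' (\<phi> u) = rk u"
      unfolding \<phi>_def part[OF that] by (auto intro: inv_into_into f_inv_into_f)
  qed
  have "bij_betw \<phi> F (\<beta> F)" if F: "F \<in> P" for F
  proof -
    have "bij_betw (inv_into (\<beta> F) rk' \<circ> rk) F (\<beta> F)"
      by (rule bij_betw_trans[OF rk[OF F] bij_betw_inv_into[OF rk'[OF F]]])
    then show ?thesis
      by (rule bij_betw_cong[THEN iffD1, rotated]) (simp add: \<phi>_def part[OF F])
  qed
  moreover have "disjoint_family_on \<beta> P"
    using \<beta> \<beta>Q partition_onD2[OF Q(1)]
    unfolding disjoint_family_on_def bij_betw_def by (metis disjointD inj_onD)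
  ultimately have "bij_betw \<phi> (\<Union>F\<in>P. F) (\<Union>F\<in>P. \<beta> F)"
    by (intro bij_betw_UNION_disjoint)
  moreover have "(\<Union>F\<in>P. F) = V" using partition_onD1[OF P(1)] by simp
  moreover have "(\<Union>F\<in>P. \<beta> F) = W" using partition_onD1[OF Q(1)] \<beta> by (simp add: bij_betw_def)
  ultimately have "bij_betw \<phi> V W" by simp
  moreover have "precedes P rk v u \<longleftrightarrow> precedes Q rk' (\<phi> v) (\<phi> u)" if uV: "u \<in> V" and vV: "v \<in> V" for u v
  proof -
    obtain F where F: "F \<in> P" "u \<in> F" using uV P(1) by (metis UnionE partition_onD1)
    obtain H where H: "H \<in> P" "v \<in> H" using vV P(1) by (metis UnionE partition_onD1)
    have "\<beta> F = \<beta> H \<longleftrightarrow> F = H" using \<beta> F(1) H(1) by (auto simp: bij_betw_def inj_on_def)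
    then show ?thesis
      using precedes_iff[OF partition_onD2[OF P(1)] F H, of rk]
        precedes_iff[OF partition_onD2[OF Q(1)] \<beta>Q[OF F(1)] \<phi>(1)[OF F] \<beta>Q[OF H(1)] \<phi>(1)[OF H], of rk']
        \<phi>(2)[OF F] \<phi>(2)[OF H] by simp
  qed
  ultimately show ?thesis by (rule that)
qed

section \<open>A concrete balanced join\<close>

text \<open>Residue classes modulo \<open>k\<close> are the most convenient balanced partition of \<open>{..<n}\<close>; the natural order makes each
of them a transitive tournament.\<close>

definition residue_join :: "nat \<Rightarrow> nat \<Rightarrow> (nat, nat \<times> nat) pre_digraph" where
  "residue_join n k = \<lparr>verts = {..<n},
     arcs = {(u, v). u < n \<and> v < n \<and> u \<noteq> v \<and> (u mod k = v mod k \<longrightarrow> u < v)}, tail = fst, head = snd\<rparr>"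

lemma residue_join_arc:
  "u \<rightarrow>\<^bsub>residue_join n k\<^esub> v \<longleftrightarrow> u < n \<and> v < n \<and> u \<noteq> v \<and> (u mod k = v mod k \<longrightarrow> u < v)"
  by (auto simp: residue_join_def arcs_ends_conv image_iff)

lemma digraph_residue_join: "digraph (residue_join n k)"
proof
  have "arcs (residue_join n k) \<subseteq> {..<n} \<times> {..<n}" by (auto simp: residue_join_def)
  then show "finite (arcs (residue_join n k))" by (rule finite_subset) simp
qed (auto simp: residue_join_def arc_to_ends_def)

lemma card_residue_class:
  assumes "r < k"
  shows "card {u. u < n \<and> u mod k = r} = n div k + of_bool (r < n mod k)"
proof (induction n)
  case (Suc n)
  have "{u. u < Suc n \<and> u mod k = r} = {u. u < n \<and> u mod k = r} \<union> (if n mod k = r then {n} else {})"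
    by (auto simp: less_Suc_eq)
  then have "card {u. u < Suc n \<and> u mod k = r} = card {u. u < n \<and> u mod k = r} + of_bool (n mod k = r)"
    by simp
  then show ?case using Suc assms by (auto simp: div_Suc mod_Suc)
qed simp

lemma transitive_tournament_of_increasing_arcs:
  fixes H :: "(nat, 'b) pre_digraph"
  assumes H: "digraph H"
    and arcs: "\<And>u v. u \<in> verts H \<Longrightarrow> v \<in> verts H \<Longrightarrow> u \<rightarrow>\<^bsub>H\<^esub> v \<longleftrightarrow> u < v"
  shows "transitive_tournament H"
proof -
  interpret digraph H by fact
  let ?n = "card (verts H)"
  have out: "out_degree H u = card {v \<in> verts H. u < v}" if "u \<in> verts H" for u
    unfolding out_degree_eq_card_dominated using arcs[OF that] by (metis (no_types, lifting))
  have decreasing: "out_degree H v < out_degree H u" if "u \<in> verts H" "v \<in> verts H" "u < v" for u v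
    unfolding out[OF that(1)] out[OF that(2)] using that by (intro psubset_card_mono) auto
  have "inj_on (out_degree H) (verts H)"
    by (rule inj_onI) (metis decreasing less_irrefl linorder_neqE_nat)
  moreover have "out_degree H ` verts H \<subseteq> {0..<?n}"
  proof
    fix d assume "d \<in> out_degree H ` verts H"
    then obtain u where "u \<in> verts H" "d = out_degree H u" by blast
    then have "d < ?n" unfolding out[OF \<open>u \<in> verts H\<close>] by (auto intro!: psubset_card_mono)
    then show "d \<in> {0..<?n}" by simp
  qed
  ultimately have "out_degree H ` verts H = {0..<?n}"
    by (intro card_subset_eq) (auto simp: card_image)
  moreover have "tournament H" using H arcs by (auto simp: tournament_def)
  ultimately show ?thesis by (simp add: transitive_tournament_def)
qed

lemma residue_join_balanced:
  assumes "0 < k" "k \<le> n"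
  shows "residue_join n k \<in> balanced_transitive_joins n k"
proof -
  let ?T = "residue_join n k" and ?part = "\<lambda>r. {u. u < n \<and> u mod k = r}"
  let ?P = "?part ` {..<k}"
  have verts: "verts ?T = {..<n}" by (simp add: residue_join_def)
  have member: "r \<in> ?part r" if "r < k" for r using that assms by simp
  have "inj_on ?part {..<k}"
    using member by (intro inj_onI) fastforce
  then have card: "card ?P = k" by (simp add: card_image)
  have "partition_on (verts ?T) ?P"
  proof (rule partition_onI)
    show "\<Union> ?P = verts ?T" using assms by (auto simp: verts)
    show "{} \<notin> ?P" using member by blast
  qed (auto simp: disjnt_def)
  moreover have "transitive_tournament (induce_subgraph ?T F)" if "F \<in> ?P" for F
  proof (rule transitive_tournament_of_increasing_arcs)
    interpret digraph ?T by (rule digraph_residue_join)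
    show "digraph (induce_subgraph ?T F)"
      by (intro digraphI_induced induced_induce) (use that in \<open>auto simp: verts\<close>)
    show "u \<rightarrow>\<^bsub>induce_subgraph ?T F\<^esub> v \<longleftrightarrow> u < v"
      if "u \<in> verts (induce_subgraph ?T F)" "v \<in> verts (induce_subgraph ?T F)" for u v
      using that \<open>F \<in> ?P\<close> by (auto simp: dominates_induce_subgraph_iff residue_join_arc)
  qed
  moreover have "u \<rightarrow>\<^bsub>?T\<^esub> v \<and> v \<rightarrow>\<^bsub>?T\<^esub> u"
    if "F \<in> ?P" "H \<in> ?P" "F \<noteq> H" "u \<in> F" "v \<in> H" for F H u v
    using that by (auto simp: residue_join_arc)
  ultimately have join: "transitive_join_partition ?T ?P"
    unfolding transitive_join_partition_def by blast
  have "\<bar>int (card F) - int (card H)\<bar> \<le> 1" if "F \<in> ?P" "H \<in> ?P" for F H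
    using that by (auto simp: card_residue_class)
  then show ?thesis
    using join card digraph_residue_join[of n k] unfolding balanced_transitive_joins_def transitive_join_class_def
    by (auto simp: verts)
qed

theorem theorem3p3:
  fixes \<alpha> :: real and n k :: nat
  assumes "0 \<le> \<alpha>" and "\<alpha> < 1" and "2 \<le> k" and "k \<le> n"
  shows "(\<exists>T :: (nat, nat \<times> nat) pre_digraph. T \<in> balanced_transitive_joins n k) \<and>
    (\<forall>T :: ('a, 'b) pre_digraph. T \<in> balanced_transitive_joins n k \<longrightarrow>
       T \<in> dichromatic_class n k \<and>
       (\<forall>G :: ('c, 'd) pre_digraph. G \<in> dichromatic_class n k \<longrightarrow>
          mu_alpha \<alpha> T \<le> mu_alpha \<alpha> G \<and>
          (mu_alpha \<alpha> G = mu_alpha \<alpha> T \<longrightarrow> digraph_iso G T)))"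
proof (intro conjI allI impI)
  show "\<exists>T :: (nat, nat \<times> nat) pre_digraph. T \<in> balanced_transitive_joins n k"
    using residue_join_balanced[of k n] assms by auto
next
  fix T :: "('a, 'b) pre_digraph"
  assume "T \<in> balanced_transitive_joins n k"
  then obtain Q where T: "digraph T" "card (verts T) = n" and join: "transitive_join_partition T Q"
    and Q: "card Q = k" and diff: "\<And>V W. V \<in> Q \<Longrightarrow> W \<in> Q \<Longrightarrow> \<bar>int (card V) - int (card W)\<bar> \<le> 1"
    by (auto simp: balanced_transitive_joins_def transitive_join_class_def)
  have two: "2 \<le> card Q" using Q assms(3) by simp
  have balanced: "\<forall>V\<in>Q. \<forall>W\<in>Q. card V \<le> Suc (card W)"
    using diff by fastforce
  have partQ: "partition_on (verts T) Q" using join by (simp add: transitive_join_partition_def)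
  show "T \<in> dichromatic_class n k"
    using T Q transitive_join_strongly_connected[OF T(1) join two]
      transitive_join_dichromatic_number[OF T(1) join] by (simp add: dichromatic_class_def)
  fix G :: "('c, 'd) pre_digraph"
  assume "G \<in> dichromatic_class n k"
  then have G: "digraph G" "strongly_connected G" "card (verts G) = n" "dichromatic_number G = k"
    by (auto simp: dichromatic_class_def)
  obtain P where P: "partition_on (verts G) P" "card P = k" and acyc: "\<And>F. F \<in> P \<Longrightarrow> acyclic_set G F"
    using dichromatic_number_attained[OF G(1)] G(4) by blast
  obtain rk where rk: "ranking P rk" and order: "\<forall>u v. precedes P rk v u \<longrightarrow> \<not> u \<rightarrow>\<^bsub>G\<^esub> v"
    using acyclic_partition_ranking[OF G(1) P(1) acyc] by blast
  have "card P = card Q" "card (verts G) = card (verts T)" using P Q G T by simp_all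
  note compare = mu_alpha_balanced_join_le[OF assms(1,2) G(1,2) P(1) rk order T(1) join balanced two this]
  show "mu_alpha \<alpha> T \<le> mu_alpha \<alpha> G" by (rule compare(1))
  assume "mu_alpha \<alpha> G = mu_alpha \<alpha> T"
  from compare(2)[OF this] obtain q where sizes: "\<And>F. F \<in> P \<Longrightarrow> card F \<in> {q, Suc q}"
      "\<And>F. F \<in> Q \<Longrightarrow> card F \<in> {q, Suc q}"
    and dist: "\<And>u v. u \<in> verts G \<Longrightarrow> v \<in> verts G \<Longrightarrow> distance G u v = join_distance P rk u v"
    by blast
  interpret G: digraph G by fact
  interpret T: digraph T by fact
  obtain rk' where rk': "ranking Q rk'" and arcs_T: "\<And>u v. u \<in> verts T \<Longrightarrow> v \<in> verts T \<Longrightarrow>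
      u \<rightarrow>\<^bsub>T\<^esub> v \<longleftrightarrow> u \<noteq> v \<and> \<not> precedes Q rk' v u"
    using transitive_join_ranking[OF T(1) join] by blast
  have arcs_G: "u \<rightarrow>\<^bsub>G\<^esub> v \<longleftrightarrow> u \<noteq> v \<and> \<not> precedes P rk v u" if uv: "u \<in> verts G" "v \<in> verts G" for u v
  proof
    assume "u \<rightarrow>\<^bsub>G\<^esub> v"
    then show "u \<noteq> v \<and> \<not> precedes P rk v u" using order G.adj_not_same by blast
  next
    assume "u \<noteq> v \<and> \<not> precedes P rk v u"
    then have "u \<noteq> v" "distance G u v = 1" using dist[OF uv] by (simp_all add: join_distance_def)
    then show "u \<rightarrow>\<^bsub>G\<^esub> v"
      using G.distance_ge(2)[of u v] G(2) uv by (fastforce simp: strongly_connected_def)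
  qed
  have fin: "finite P" "finite Q"
    using finite_elements P(1) partQ G.finite_verts T.finite_verts by blast+
  have "sum card P = sum card Q"
    using sum_card_partition[OF G.finite_verts P(1) rk] sum_card_partition[OF T.finite_verts partQ rk'] G(3) T(2)
    by simp
  then obtain \<beta> where \<beta>: "bij_betw \<beta> P Q" "\<And>F. F \<in> P \<Longrightarrow> card (\<beta> F) = card F"
    using size_preserving_bijection_of_balanced[where s = card and t = card and q = q,
        OF fin \<open>card P = card Q\<close>] sizes by blast
  obtain \<phi> where \<phi>: "bij_betw \<phi> (verts G) (verts T)" and pres: "\<And>u v. u \<in> verts G \<Longrightarrow> v \<in> verts G \<Longrightarrow>
      precedes P rk v u \<longleftrightarrow> precedes Q rk' (\<phi> v) (\<phi> u)"
    using ranked_partition_isomorphism[OF P(1) rk partQ rk' \<beta>] by blast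
  show "digraph_iso G T"
  proof (rule digraph_iso_of_arc_preserving[OF G(1) T(1) \<phi>])
    fix u v assume uv: "u \<in> verts G" "v \<in> verts G"
    then have "\<phi> u \<in> verts T" "\<phi> v \<in> verts T" "\<phi> u = \<phi> v \<longleftrightarrow> u = v"
      using \<phi> by (auto simp: bij_betw_def inj_on_def)
    then show "u \<rightarrow>\<^bsub>G\<^esub> v \<longleftrightarrow> \<phi> u \<rightarrow>\<^bsub>T\<^esub> \<phi> v" using arcs_G[OF uv] arcs_T pres[OF uv] by simp
  qed
qed

end
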